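(* Let $\varphi$ be a continuous random dynamical system on the Polish space $E$ (equipped with the metric $d$) over the metric dynamical system $(\Omega,\mathscr F,P,(\vartheta_t)_{t\in\mathbb R})$. The following are equivalent: (i) $\varphi$ has a strong $C$-attractor. (ii) For every $\varepsilon>0$ there exists a compact subset $C_\varepsilon\subset E$ such that for each $\delta>0$ and each compact subset $K$ of $E$ it holds that $$P\Bigl\{\omega:\ K\subset\bigcup_{s\ge 0}\bigcap_{t\ge s}\varphi(t,\vartheta_{-t}\omega)^{-1}(C_\varepsilon^\delta)\Bigr\}\ \ge\ 1-\varepsilon .$$ (iii) There exists a compact strongly $C$-attracting set $\omega\mapsto K(\omega)$, i.e. a compact random set $K$ which strongly attracts every compact subset of $E$.
   Context: $E$ is a Polish space with Borel $\sigma$-algebra $\mathscr B$, equipped with a complete metric $d$ inducing its topology. For $x\in E$, $A\subset E$: $d(x,A)=\inf_{a\in A}d(x,a)$; for non-empty sets, $d(B,A)=\sup_{b\in B}d(b,A)$. For $A\subset E$ and $\delta>0$, $A^\delta$ is the closed $\delta$-neighbourhood of $A$. A metric dynamical system $(\Omega,\mathscr F,P,(\vartheta_t)_{t\in\mathbb R})$ is a probability space with maps $\vartheta_t:\Omega\to\Omega$ such that $(\omega,t)\mapsto\vartheta_t\omega$ is $(\mathscr F\otimes\mathscr B(\mathbb R),\mathscr F)$-measurable, $\vartheta_{s+t}=\vartheta_s\circ\vartheta_t$, $\vartheta_0=\mathrm{Id}_\Omega$, and each $\vartheta_t$ preserves $P$. A random dynamical system (RDS) is a $(\mathscr B([0,\infty))\otimes\mathscr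 B\otimes\mathscr F,\mathscr B)$-measurable map $\varphi:[0,\infty)\times E\times\Omega\to E$, $(t,x,\omega)\mapsto\varphi(t,x,\omega)=\varphi(t,\omega)(x)$, with $\varphi(0,\omega)=\mathrm{Id}_E$ and $\varphi(t+s,\omega)=\varphi(t,\vartheta_s\omega)\circ\varphi(s,\omega)$ for all $s,t\ge0$, $\omega\in\Omega$. It is continuous if $x\mapsto\varphi(t,x,\omega)$ is continuous for all $(t,\omega)$; no continuity in $t$ is assumed. $\varphi(t,\vartheta_{-t}\omega)^{-1}(C)$ denotes the preimage of $C$ under the map $x\mapsto\varphi(t,\vartheta_{-t}\omega)(x)$. A compact random set is a map $\omega\mapsto A(\omega)$ with values in the compact subsets of $E$ such that $\omega\mapsto d(x,A(\omega))$ is measurable for every $x\in E$; random sets are assumed non-empty almost surely. A compact random set $K$ strongly attracts a (deterministic) set $B\subset E$ if $\lim_{t\to\infty}d(\varphi(t,\vartheta_{-t}\omega)B,K(\omega))=0$ for $P$-almost every $\omega$. A strong $C$-attractor is a compact random set $A$ such that (a) $A$ is strictly $\varphi$-invariant: for each $t\ge0$ there is a set $\Omega_t$ of full measure with $\varphi(t,\omega)(A(\omega))=A(\vartheta_t\omega)$ for all $\omega\in\Omega_t$; and (b) for every compact $B\subset E$, $\lim_{t\to\infty}\sup_{x\in B}d(\varphi(t,\vartheta_{-t}\omega)(x),A(\omega))=0$ almost surely.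
   Formalization: In (ii) the entrance time s is required to be the same for all points of K (the printed event lets s depend on the point, which makes the equivalence false), and P of this event is taken in the completion of P, since the event need not lie in F. *)

theory Defs
  imports "HOL-Probability.Probability"
begin

(* The state space E is a whole type of class polish_space: there "dist" is a complete metric
   inducing the separable topology. *)

(* Values are taken in [0,\<infinity>] so that inf {} = \<infinity>; the library's infdist has infdist x {} = 0,
   which would make every neighbourhood of {} the whole space. *)
definition dist_to_set :: "'e::metric_space \<Rightarrow> 'e set \<Rightarrow> ennreal" where
  "dist_to_set x A = (INF a\<in>A. ennreal (dist x a))"

definition excess :: "'e::metric_space set \<Rightarrow> 'e set \<Rightarrow> ennreal" where
  "excess B A = (SUP b\<in>B. dist_to_set b A)"

definition closed_nbhd :: "real \<Rightarrow> 'e::metric_space set \<Rightarrow> 'e set" where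
  "closed_nbhd \<delta> A = {x. dist_to_set x A \<le> ennreal \<delta>}"

locale metric_ds = prob_space M for M :: "'w measure" +
  fixes \<theta> :: "real \<Rightarrow> 'w \<Rightarrow> 'w"
  assumes shift_measurable: "(\<lambda>(\<omega>, t). \<theta> t \<omega>) \<in> M \<Otimes>\<^sub>M borel \<rightarrow>\<^sub>M M"
    and shift_add: "\<And>s t \<omega>. \<omega> \<in> space M \<Longrightarrow> \<theta> (s + t) \<omega> = \<theta> s (\<theta> t \<omega>)"
    and shift_zero: "\<And>\<omega>. \<omega> \<in> space M \<Longrightarrow> \<theta> 0 \<omega> = \<omega>"
    and shift_preserving: "\<And>t. distr M M (\<theta> t) = M"

(* \<phi> t \<omega> x is only meaningful for t \<ge> 0 and \<omega> \<in> space M. *)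
locale rds = metric_ds M \<theta> for M :: "'w measure" and \<theta> :: "real \<Rightarrow> 'w \<Rightarrow> 'w" +
  fixes \<phi> :: "real \<Rightarrow> 'w \<Rightarrow> 'e::polish_space \<Rightarrow> 'e"
  assumes cocycle_measurable:
      "(\<lambda>(t, x, \<omega>). \<phi> t \<omega> x) \<in> restrict_space borel {0..} \<Otimes>\<^sub>M (borel \<Otimes>\<^sub>M M) \<rightarrow>\<^sub>M borel"
    and cocycle_zero: "\<And>\<omega> x. \<omega> \<in> space M \<Longrightarrow> \<phi> 0 \<omega> x = x"
    and cocycle_add: "\<And>s t \<omega> x. \<omega> \<in> space M \<Longrightarrow> 0 \<le> s \<Longrightarrow> 0 \<le> t \<Longrightarrow>
      \<phi> (t + s) \<omega> x = \<phi> t (\<theta> s \<omega>) (\<phi> s \<omega> x)"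

locale continuous_rds = rds M \<theta> \<phi>
  for M :: "'w measure" and \<theta> :: "real \<Rightarrow> 'w \<Rightarrow> 'w"
    and \<phi> :: "real \<Rightarrow> 'w \<Rightarrow> 'e::polish_space \<Rightarrow> 'e" +
  assumes cocycle_continuous:
      "\<And>t \<omega>. \<omega> \<in> space M \<Longrightarrow> 0 \<le> t \<Longrightarrow> continuous_on UNIV (\<phi> t \<omega>)"

definition compact_random_set :: "'w measure \<Rightarrow> ('w \<Rightarrow> 'e::metric_space set) \<Rightarrow> bool" where
  "compact_random_set M A \<longleftrightarrow>
     (\<forall>\<omega>\<in>space M. compact (A \<omega>)) \<and>
     (\<forall>x. (\<lambda>\<omega>. dist_to_set x (A \<omega>)) \<in> borel_measurable M) \<and>
     (AE \<omega> in M. A \<omega> \<noteq> {})"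

definition strongly_attracts ::
  "'w measure \<Rightarrow> (real \<Rightarrow> 'w \<Rightarrow> 'w) \<Rightarrow> (real \<Rightarrow> 'w \<Rightarrow> 'e \<Rightarrow> 'e) \<Rightarrow>
   ('w \<Rightarrow> 'e::metric_space set) \<Rightarrow> 'e set \<Rightarrow> bool" where
  "strongly_attracts M \<theta> \<phi> K B \<longleftrightarrow>
     (AE \<omega> in M. ((\<lambda>t. excess (\<phi> t (\<theta> (- t) \<omega>) ` B) (K \<omega>)) \<longlongrightarrow> 0) at_top)"

definition strictly_invariant ::
  "'w measure \<Rightarrow> (real \<Rightarrow> 'w \<Rightarrow> 'w) \<Rightarrow> (real \<Rightarrow> 'w \<Rightarrow> 'e \<Rightarrow> 'e) \<Rightarrow>
   ('w \<Rightarrow> 'e set) \<Rightarrow> bool" where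
  "strictly_invariant M \<theta> \<phi> A \<longleftrightarrow>
     (\<forall>t\<ge>0. AE \<omega> in M. \<phi> t \<omega> ` A \<omega> = A (\<theta> t \<omega>))"

definition strong_C_attractor ::
  "'w measure \<Rightarrow> (real \<Rightarrow> 'w \<Rightarrow> 'w) \<Rightarrow> (real \<Rightarrow> 'w \<Rightarrow> 'e \<Rightarrow> 'e) \<Rightarrow>
   ('w \<Rightarrow> 'e::metric_space set) \<Rightarrow> bool" where
  "strong_C_attractor M \<theta> \<phi> A \<longleftrightarrow>
     compact_random_set M A \<and>
     strictly_invariant M \<theta> \<phi> A \<and>
     (\<forall>B. compact B \<longrightarrow>
        (AE \<omega> in M. ((\<lambda>t. SUP x\<in>B. dist_to_set (\<phi> t (\<theta> (- t) \<omega>) x) (A \<omega>)) \<longlongrightarrow> 0) at_top))"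

(* The entrance time s is one time for the whole set K. With the pointwise event
   K \<subseteq> (\<Union>s\<in>{0..}. \<Inter>t\<in>{s..}. \<phi> t (\<theta> (- t) \<omega>) -` D), where s may depend on x \<in> K, the
   absorption criterion does not imply the existence of an attractor. Counterexample (\<Omega> a single
   point): for a \<in> \<real> let g a = (sech a, sech a * tanh a), a loop in the plane homoclinic to 0, and
   let E be the closed subset {0} \<union> {g a * e_n | a \<in> \<real>, n \<in> \<nat>} of l^2(\<nat>; \<real>^2), with
   \<phi> t 0 = 0 and \<phi> t (g a * e_n) = g (a + t) * e_n. Every orbit converges to 0, but
   the orbit of the compact set {0} \<union> {g (-n) * e_n | n \<in> \<nat>} contains g 0 * e_n at time n.

   As t ranges over a continuum and \<phi> need not be continuous in t, the absorption event for a
   closed neighbourhood D and compact K is in general only measurable for the completion of M (by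
   measurable projection), so its probability is to be taken there. *)
definition absorption_event ::
  "'w measure \<Rightarrow> (real \<Rightarrow> 'w \<Rightarrow> 'w) \<Rightarrow> (real \<Rightarrow> 'w \<Rightarrow> 'e \<Rightarrow> 'e) \<Rightarrow>
   'e set \<Rightarrow> 'e set \<Rightarrow> 'w set" where
  "absorption_event M \<theta> \<phi> K D =
     {\<omega> \<in> space M. \<exists>s\<ge>0. K \<subseteq> (\<Inter>t\<in>{s..}. \<phi> t (\<theta> (- t) \<omega>) -` D)}"

end

(* The implication from (i) to (iii) is immediate. From (iii) to (ii): the law of a compact random
   set K is tight, so K lies in a deterministic compact C with probability at least 1 - eps, and on
   that event attraction by K is attraction by C. As the absorption event involves uncountably many
   times, the measurable projection theorem is needed to see that it has a probability at all.

   From (ii) to (i): let C_m belong to eps = 1/(m+2), let B_k be the union of C_0, ..., C_k, and let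
   A be the closure of the union over k of the pullback limit sets of B_k. All of these limit sets
   lie in C_m with probability at least 1 - 1/(m+2), so A is almost surely compact. For an arbitrary
   compact B, its limit set Omega_B is invariant, and by recurrence Omega_B(theta_{-n} omega) lies
   in C_m for infinitely many n with probability at least 1 - 1/(m+2). Then
   Omega_B(omega) = phi(n, theta_{-n} omega) Omega_B(theta_{-n} omega) is contained in the image of
   C_m for infinitely many n, hence in the limit set of C_m. So A contains Omega_B almost surely. *)

theory Submission
  imports Defs
begin

section \<open>Suslin schemes and measurable projection\<close>

text \<open>Each compact set has its own exceptional null set, and \<open>E\<close> need not be
  sigma-compact, so the attractor cannot simply be put together from the limit sets of all compact
  sets. Countably many sets must suffice, and the only candidates are the \<open>C m\<close>;
  recurrence under the measure preserving shift ties every other compact set to them. Hypothesis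
  (ii) offers one event for each radius and each compact set. Intersecting countably many such
  events would ruin the lower bound. A limsup of events keeps it, and along growing compact sets and
  shrinking radii a limsup still controls every pair. Two time scales coexist: invariance and
  attraction concern real times, measurability of the attractor wants countably many times. They are
  reconciled on an event of full measure. The projection theorem rests on the Suslin operation.
  Product measurable sets arise by it from rectangles with closed time side, compactness of bounded
  time intervals lets it pass through the projection, and its results are measurable for the
  completion.\<close>

lemma dependent_seq_choice:
  fixes Q :: "nat \<Rightarrow> (nat \<Rightarrow> nat) \<Rightarrow> bool"
  assumes base: "Q 0 \<sigma>0"
    and step: "\<And>n \<sigma>. Q n \<sigma> \<Longrightarrow> \<exists>j. Q (Suc n) (\<sigma>(n := j))"
    and local: "\<And>n \<sigma> \<tau>. (\<forall>i<n. \<sigma> i = \<tau> i) \<Longrightarrow> Q n \<sigma> \<Longrightarrow> Q n \<tau>"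
  shows "\<exists>\<sigma>. \<forall>n. Q n \<sigma>"
proof -
  have "\<exists>s. \<forall>n. Q n (s n) \<and> (\<exists>j. s (Suc n) = (s n)(n := j))"
    using base step by (intro dependent_nat_choice) blast+
  then obtain s where s: "\<And>n. Q n (s n)" "\<And>n. \<exists>j. s (Suc n) = (s n)(n := j)"
    by blast
  \<comment> \<open>Coordinate \<open>i\<close> is set in passing to \<open>s (Suc i)\<close> and
    never altered afterwards, so this diagonal agrees with \<open>s n\<close> below
    \<open>n\<close>, which by \<open>local\<close> is all that \<open>Q n\<close> sees.\<close>
  define \<sigma> where "\<sigma> i = s (Suc i) i" for i
  have "\<forall>i<n. s n i = \<sigma> i" for n
  proof (induction n)
    case (Suc n)
    obtain j where "s (Suc n) = (s n)(n := j)" using s(2) by blast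
    with Suc show ?case by (auto simp: \<sigma>_def less_Suc_eq)
  qed simp
  with s(1) local show ?thesis by blast
qed

text \<open>Koenig's lemma: a prefix that extends to every depth has only finitely many admissible
  continuations, so one of them again extends to every depth. This recovers a full branch from
  approximations of finite level.\<close>

lemma koenig_bounded_branch:
  fixes P :: "nat \<Rightarrow> (nat \<Rightarrow> nat) \<Rightarrow> bool"
  assumes local: "\<And>n \<sigma> \<tau>. (\<forall>i<n. \<sigma> i = \<tau> i) \<Longrightarrow> P n \<sigma> \<Longrightarrow> P n \<tau>"
    and ex: "\<And>n. \<exists>\<sigma>. (\<forall>i<n. \<sigma> i \<le> k i) \<and> (\<forall>m\<le>n. P m \<sigma>)"
  shows "\<exists>\<sigma>. \<forall>n. P n \<sigma>"
proof -
  define good where "good N \<tau> \<longleftrightarrow> (\<forall>i<N. \<tau> i \<le> k i) \<and> (\<forall>m\<le>N. P m \<tau>)" for N \<tau>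
  have good_mono: "good N \<tau> \<Longrightarrow> N' \<le> N \<Longrightarrow> good N' \<tau>" for N N' \<tau>
    unfolding good_def by auto
  define Q where "Q n \<sigma> \<longleftrightarrow> (\<forall>N. \<exists>\<tau>. (\<forall>i<n. \<tau> i = \<sigma> i) \<and> good N \<tau>)" for n \<sigma>
  have "\<exists>\<sigma>. \<forall>n. Q n \<sigma>"
  proof (rule dependent_seq_choice)
    show "Q 0 (\<lambda>_. 0)" using ex unfolding Q_def good_def by simp
  next
    fix n \<sigma> assume Q: "Q n \<sigma>"
    show "\<exists>j. Q (Suc n) (\<sigma>(n := j))"
    proof (rule ccontr)
      assume "\<nexists>j. Q (Suc n) (\<sigma>(n := j))"
      then have "\<forall>j. \<exists>N. \<forall>\<tau>. (\<forall>i<Suc n. \<tau> i = (\<sigma>(n := j)) i) \<longrightarrow> \<not> good N \<tau>"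
        unfolding Q_def by blast
      then obtain N where N: "\<And>j \<tau>. (\<forall>i<Suc n. \<tau> i = (\<sigma>(n := j)) i) \<Longrightarrow> \<not> good (N j) \<tau>"
        by metis
      \<comment> \<open>Only the values \<open>j \<le> k n\<close> can occur, so finitely many
        refuting depths have a maximum; \<open>Suc n\<close> makes \<open>good N'\<close> include
        the bound on \<open>\<tau> n\<close>.\<close>
      define N' where "N' = max (Suc n) (Max (N ` {..k n}))"
      obtain \<tau> where \<tau>: "\<forall>i<n. \<tau> i = \<sigma> i" "good N' \<tau>" using Q unfolding Q_def by blast
      have "\<tau> n \<le> k n" using \<tau>(2) unfolding good_def N'_def by auto
      then have "N (\<tau> n) \<le> N'" unfolding N'_def by (intro max.coboundedI2 Max_ge) auto
      then have "good (N (\<tau> n)) \<tau>" using \<tau>(2) good_mono by blast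
      moreover have "\<forall>i<Suc n. \<tau> i = (\<sigma>(n := \<tau> n)) i" using \<tau>(1) by (auto simp: less_Suc_eq)
      ultimately show False using N by blast
    qed
  next
    fix n and \<sigma> \<tau> :: "nat \<Rightarrow> nat" assume "\<forall>i<n. \<sigma> i = \<tau> i" "Q n \<sigma>"
    then show "Q n \<tau>" unfolding Q_def by simp
  qed
  then obtain \<sigma> where \<sigma>: "\<And>n. Q n \<sigma>" by blast
  have "P n \<sigma>" for n
  proof -
    obtain \<tau> where "\<forall>i<n. \<tau> i = \<sigma> i" "good n \<tau>" using \<sigma> unfolding Q_def by blast
    then show ?thesis using local unfolding good_def by blast
  qed
  then show ?thesis by blast
qed

text \<open>A scheme is a family of sets indexed by finite sequences of naturals; the finite sequence
  is encoded as a function of which only the first \<open>n\<close> values matter.\<close>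

definition suslin_scheme :: "'a set set \<Rightarrow> (nat \<Rightarrow> (nat \<Rightarrow> nat) \<Rightarrow> 'a set) \<Rightarrow> bool" where
  "suslin_scheme R B \<longleftrightarrow>
     (\<forall>n \<sigma>. B n \<sigma> \<in> R) \<and> (\<forall>n \<sigma> \<tau>. (\<forall>i<n. \<sigma> i = \<tau> i) \<longrightarrow> B n \<sigma> = B n \<tau>)"

definition suslin :: "'a set set \<Rightarrow> 'a set \<Rightarrow> bool" where
  "suslin R S \<longleftrightarrow> (\<exists>B. suslin_scheme R B \<and> S = (\<Union>\<sigma>. \<Inter>n. B n \<sigma>))"

lemma suslin_schemeD:
  assumes "suslin_scheme R B"
  shows "B n \<sigma> \<in> R" and "(\<And>i. i < n \<Longrightarrow> \<sigma> i = \<tau> i) \<Longrightarrow> B n \<sigma> = B n \<tau>"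
  using assms unfolding suslin_scheme_def by blast+

section \<open>Closure properties of the Suslin operation\<close>

lemma suslin_base:
  assumes "S \<in> R"
  shows "suslin R S"
  unfolding suslin_def suslin_scheme_def by (rule exI[of _ "\<lambda>_ _. S"]) (use assms in auto)

text \<open>A branch for the union carries the chosen member \<open>m\<close> as its first index,
  followed by a branch for \<open>S m\<close>. Level 0 sees no index, so it has to be the whole
  space \<open>X\<close>.\<close>

lemma suslin_UN:
  fixes S :: "nat \<Rightarrow> 'a set"
  assumes X: "X \<in> R" "\<And>A. A \<in> R \<Longrightarrow> A \<subseteq> X" and S: "\<And>m. suslin R (S m)"
  shows "suslin R (\<Union>m. S m)"
proof -
  obtain B where B: "\<And>m. suslin_scheme R (B m)" and S_eq: "\<And>m. S m = (\<Union>\<sigma>. \<Inter>n. B m n \<sigma>)"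
    using S unfolding suslin_def by metis
  define C where "C n \<tau> = (case n of 0 \<Rightarrow> X | Suc n' \<Rightarrow> B (\<tau> 0) n' (\<lambda>i. \<tau> (Suc i)))" for n \<tau>
  have "suslin_scheme R C"
    unfolding suslin_scheme_def
  proof (intro conjI allI impI)
    show "C n \<tau> \<in> R" for n \<tau>
      using X suslin_schemeD(1)[OF B] by (auto simp: C_def split: nat.split)
    show "C n \<sigma> = C n \<tau>" if "\<forall>i<n. \<sigma> i = \<tau> i" for n \<sigma> \<tau>
    proof (cases n)
      case (Suc n')
      with that have "\<sigma> 0 = \<tau> 0" "\<And>i. i < n' \<Longrightarrow> \<sigma> (Suc i) = \<tau> (Suc i)" by auto
      with Suc show ?thesis
        using suslin_schemeD(2)[OF B, of n' "\<lambda>i. \<sigma> (Suc i)" "\<lambda>i. \<tau> (Suc i)"] by (simp add: C_def)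
    qed (simp add: C_def)
  qed
  moreover have "(\<Union>m. S m) = (\<Union>\<tau>. \<Inter>n. C n \<tau>)"
  proof (intro equalityI subsetI)
    fix x assume "x \<in> (\<Union>m. S m)"
    then obtain m \<sigma> where x: "\<And>n. x \<in> B m n \<sigma>" using S_eq by auto
    have "x \<in> X" using x[of 0] X suslin_schemeD(1)[OF B] by blast
    then have "x \<in> C n (case_nat m \<sigma>)" for n
      using x by (cases n) (auto simp: C_def)
    then show "x \<in> (\<Union>\<tau>. \<Inter>n. C n \<tau>)" by blast
  next
    fix x assume "x \<in> (\<Union>\<tau>. \<Inter>n. C n \<tau>)"
    then obtain \<tau> where x: "\<And>n. x \<in> C n \<tau>" by blast
    have "x \<in> B (\<tau> 0) n (\<lambda>i. \<tau> (Suc i))" for n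
      using x[of "Suc n"] by (simp add: C_def)
    then show "x \<in> (\<Union>m. S m)" unfolding S_eq by blast
  qed
  ultimately show ?thesis unfolding suslin_def by blast
qed

text \<open>One sequence codes countably many branches through \<open>prod_encode\<close>. A point
  lies in the intersection iff a single such sequence serves all schemes at once.\<close>

lemma suslin_INT:
  fixes S :: "nat \<Rightarrow> 'a set"
  assumes X: "X \<in> R" "\<And>A. A \<in> R \<Longrightarrow> A \<subseteq> X"
    and Int: "\<And>A B. A \<in> R \<Longrightarrow> B \<in> R \<Longrightarrow> A \<inter> B \<in> R"
    and S: "\<And>m. suslin R (S m)"
  shows "suslin R (\<Inter>m. S m)"
proof -
  obtain B where B: "\<And>m. suslin_scheme R (B m)" and S_eq: "\<And>m. S m = (\<Union>\<sigma>. \<Inter>n. B m n \<sigma>)"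
    using S unfolding suslin_def by metis
  have fin: "X \<inter> \<Inter>F \<in> R" if "finite F" "F \<subseteq> R" for F
    using that by (induction F) (auto simp: X Int Int_left_commute)
  define row :: "(nat \<Rightarrow> nat) \<Rightarrow> nat \<Rightarrow> nat \<Rightarrow> nat" where "row \<tau> m i = \<tau> (prod_encode (m, i))" for \<tau> m i
  define I where "I j = {(m, n). m \<le> j \<and> n \<le> j \<and> (\<forall>i<n. prod_encode (m, i) < j)}" for j
  define C where "C j \<tau> = X \<inter> \<Inter>((\<lambda>(m, n). B m n (row \<tau> m)) ` I j)" for j \<tau>
  have fin_I: "finite (I j)" for j
    by (rule finite_subset[of _ "{..j} \<times> {..j}"]) (auto simp: I_def)
  have "suslin_scheme R C"
    unfolding suslin_scheme_def
  proof (intro conjI allI impI)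
    show "C n \<tau> \<in> R" for n \<tau>
      unfolding C_def using fin_I suslin_schemeD(1)[OF B] by (intro fin) auto
    show "C j \<sigma> = C j \<tau>" if "\<forall>i<j. \<sigma> i = \<tau> i" for j \<sigma> \<tau>
    proof -
      have "B m n (row \<sigma> m) = B m n (row \<tau> m)" if "(m, n) \<in> I j" for m n
        using that \<open>\<forall>i<j. \<sigma> i = \<tau> i\<close> by (intro suslin_schemeD(2)[OF B]) (auto simp: I_def row_def)
      then have "(\<lambda>(m, n). B m n (row \<sigma> m)) ` I j = (\<lambda>(m, n). B m n (row \<tau> m)) ` I j"
        by (intro image_cong) auto
      then show ?thesis unfolding C_def by simp
    qed
  qed
  moreover have "(\<Inter>m. S m) = (\<Union>\<tau>. \<Inter>j. C j \<tau>)"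
  proof (intro equalityI subsetI)
    fix x assume "x \<in> (\<Inter>m. S m)"
    then have "\<forall>m. \<exists>\<sigma>. \<forall>n. x \<in> B m n \<sigma>" unfolding S_eq by auto
    then obtain s where s: "\<And>m n. x \<in> B m n (s m)" by metis
    define \<tau> where "\<tau> p = (case prod_decode p of (m, i) \<Rightarrow> s m i)" for p
    have "row \<tau> m = s m" for m by (auto simp: row_def \<tau>_def)
    moreover have "x \<in> X" using s[of 0 0] X suslin_schemeD(1)[OF B] by blast
    ultimately have "x \<in> C j \<tau>" for j using s unfolding C_def by auto
    then show "x \<in> (\<Union>\<tau>. \<Inter>j. C j \<tau>)" by blast
  next
    fix x assume "x \<in> (\<Union>\<tau>. \<Inter>n. C n \<tau>)"
    then obtain \<tau> where x: "\<And>n. x \<in> C n \<tau>" by blast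
    have "x \<in> B m n (row \<tau> m)" for m n
    proof -
      define j where "j = m + n + (\<Sum>i<n. Suc (prod_encode (m, i)))"
      have "prod_encode (m, i) < j" if "i < n" for i
      proof -
        have "Suc (prod_encode (m, i)) \<le> (\<Sum>i<n. Suc (prod_encode (m, i)))"
          using that by (intro member_le_sum) auto
        then show ?thesis unfolding j_def by simp
      qed
      then have "(m, n) \<in> I j" unfolding I_def j_def by simp
      then show ?thesis using x[of j] unfolding C_def by auto
    qed
    then show "x \<in> (\<Inter>m. S m)" unfolding S_eq by blast
  qed
  ultimately show ?thesis unfolding suslin_def by blast
qed

text \<open>Lusin's argument: bounding the index sequences coordinate by coordinate costs little outer
  measure, and what remains is a countable intersection of finite unions.\<close>

lemma (in finite_measure) suslin_inner_approx:
  assumes S: "suslin (sets M) S" and c: "c < outer_measure_of M S"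
  shows "\<exists>T\<in>sets M. T \<subseteq> S \<and> c \<le> emeasure M T"
proof -
  obtain B where B: "suslin_scheme (sets M) B" and S_eq: "S = (\<Union>\<sigma>. \<Inter>n. B n \<sigma>)"
    using S unfolding suslin_def by metis
  \<comment> \<open>The part of \<open>S\<close> reached by branches whose first \<open>n\<close>
    indices are bounded by \<open>k\<close>. It need not be measurable, hence the outer
    measure.\<close>
  define Sk where "Sk n k = (\<Union>\<sigma>\<in>{\<sigma>. \<forall>i<n. \<sigma> i \<le> k i}. \<Inter>m. B m \<sigma>)" for n and k :: "nat \<Rightarrow> nat"
  have sets_B: "B n \<sigma> \<in> sets M" for n \<sigma> using suslin_schemeD(1)[OF B] .
  have Sk_space: "Sk n k \<subseteq> space M" for n k
    using sets.sets_into_space[OF sets_B] unfolding Sk_def by blast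
  have "\<exists>k. \<forall>n. c < outer_measure_of M (Sk n k)"
  proof (rule dependent_seq_choice)
    show "c < outer_measure_of M (Sk 0 (\<lambda>_. 0))" using c unfolding Sk_def S_eq by simp
  next
    fix n k assume less: "c < outer_measure_of M (Sk n k)"
    have "Sk n k = (\<Union>j. Sk (Suc n) (k(n := j)))"
    proof (intro equalityI subsetI)
      fix x assume "x \<in> Sk n k"
      then obtain \<sigma> where "\<forall>i<n. \<sigma> i \<le> k i" "\<forall>m. x \<in> B m \<sigma>" unfolding Sk_def by auto
      then have "x \<in> Sk (Suc n) (k(n := \<sigma> n))"
        unfolding Sk_def by (auto simp: less_Suc_eq intro!: exI[of _ \<sigma>])
      then show "x \<in> (\<Union>j. Sk (Suc n) (k(n := j)))" by blast
    qed (auto simp: Sk_def less_Suc_eq)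
    moreover have "incseq (\<lambda>j. Sk (Suc n) (k(n := j)))"
      unfolding Sk_def incseq_def by (intro allI impI UN_mono) (auto simp: less_Suc_eq)
    \<comment> \<open>The outer measure is continuous along arbitrary increasing sequences of
      subsets of the space, so the strict bound \<open>c\<close> survives for some finite
      \<open>j\<close>.\<close>
    ultimately have "outer_measure_of M (Sk n k) = (SUP j. outer_measure_of M (Sk (Suc n) (k(n := j))))"
      using SUP_outer_measure_of_incseq[of "\<lambda>j. Sk (Suc n) (k(n := j))" M] Sk_space by simp
    then show "\<exists>j. c < outer_measure_of M (Sk (Suc n) (k(n := j)))"
      using less by (auto simp: less_SUP_iff)
  next
    fix n and \<sigma> \<tau> :: "nat \<Rightarrow> nat" assume "\<forall>i<n. \<sigma> i = \<tau> i" "c < outer_measure_of M (Sk n \<sigma>)"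
    moreover from this have "Sk n \<sigma> = Sk n \<tau>" unfolding Sk_def by auto
    ultimately show "c < outer_measure_of M (Sk n \<tau>)" by simp
  qed
  then obtain k where k: "\<And>n. c < outer_measure_of M (Sk n k)" by blast
  \<comment> \<open>Cutting the branches at level \<open>n\<close> leaves finitely many relevant
    prefixes. So \<open>T n\<close> is a measurable superset of \<open>Sk n k\<close>, and Koenig's
    lemma brings the intersection of all \<open>T n\<close> back into \<open>S\<close>.\<close>
  define T where "T n = (\<Union>\<sigma>\<in>{\<sigma>. \<forall>i<n. \<sigma> i \<le> k i}. \<Inter>m\<le>n. B m \<sigma>)" for n
  have T_sets: "T n \<in> sets M" for n
  proof -
    let ?\<Sigma> = "PiE {..<n} (\<lambda>i. {..k i})"
    have "T n = (\<Union>\<sigma>\<in>?\<Sigma>. \<Inter>m\<le>n. B m \<sigma>)"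
    proof (intro equalityI subsetI)
      fix x assume "x \<in> T n"
      then obtain \<sigma> where \<sigma>: "\<forall>i<n. \<sigma> i \<le> k i" "\<And>m. m \<le> n \<Longrightarrow> x \<in> B m \<sigma>" unfolding T_def by auto
      have "B m \<sigma> = B m (restrict \<sigma> {..<n})" if "m \<le> n" for m
        using that by (intro suslin_schemeD(2)[OF B]) auto
      with \<sigma> have "x \<in> (\<Inter>m\<le>n. B m (restrict \<sigma> {..<n}))" by auto
      moreover have "restrict \<sigma> {..<n} \<in> ?\<Sigma>" using \<sigma>(1) by auto
      ultimately show "x \<in> (\<Union>\<sigma>\<in>?\<Sigma>. \<Inter>m\<le>n. B m \<sigma>)" by blast
    next
      fix x assume "x \<in> (\<Union>\<sigma>\<in>?\<Sigma>. \<Inter>m\<le>n. B m \<sigma>)"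
      then show "x \<in> T n" unfolding T_def by (auto simp: PiE_iff)
    qed
    moreover have "finite ?\<Sigma>" by (intro finite_PiE) auto
    ultimately show ?thesis using sets_B by (auto intro!: sets.finite_UN sets.finite_INT)
  qed
  have "decseq T"
    unfolding decseq_Suc_iff T_def by (intro allI UN_mono) auto
  then have "(INF n. emeasure M (T n)) = emeasure M (\<Inter>n. T n)"
    using T_sets by (intro INF_emeasure_decseq) (auto simp: less_top[symmetric])
  moreover have "c \<le> emeasure M (T n)" for n
  proof -
    have "Sk n k \<subseteq> T n" unfolding Sk_def T_def by blast
    then have "outer_measure_of M (Sk n k) \<le> outer_measure_of M (T n)" by (rule outer_measure_of_mono)
    then show ?thesis using k[of n] T_sets by simp
  qed
  ultimately have "c \<le> emeasure M (\<Inter>n. T n)" by (metis INF_greatest)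
  moreover have "(\<Inter>n. T n) \<subseteq> S"
  proof
    fix x assume x: "x \<in> (\<Inter>n. T n)"
    have "\<exists>\<sigma>. \<forall>n. x \<in> B n \<sigma>"
    proof (rule koenig_bounded_branch[where k=k])
      fix n and \<sigma> \<tau> :: "nat \<Rightarrow> nat" assume "\<forall>i<n. \<sigma> i = \<tau> i" "x \<in> B n \<sigma>"
      then show "x \<in> B n \<tau>" using suslin_schemeD(2)[OF B, of n \<sigma> \<tau>] by simp
    next
      fix n
      from x have "x \<in> T n" by simp
      then show "\<exists>\<sigma>. (\<forall>i<n. \<sigma> i \<le> k i) \<and> (\<forall>m\<le>n. x \<in> B m \<sigma>)" unfolding T_def by auto
    qed
    then show "x \<in> S" unfolding S_eq by blast
  qed
  moreover have "(\<Inter>n. T n) \<in> sets M" using T_sets by auto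
  ultimately show ?thesis by blast
qed

text \<open>By \<open>suslin_inner_approx\<close> the measurable hull \<open>H\<close> and a
  suitable countable union \<open>T\<close> of measurable subsets have the same measure, so
  \<open>S\<close> lies between two measurable sets with null difference.\<close>

lemma (in finite_measure) suslin_completion:
  assumes S: "suslin (sets M) S"
  shows "S \<in> sets (completion M)"
proof -
  obtain B where B: "suslin_scheme (sets M) B" and S_eq: "S = (\<Union>\<sigma>. \<Inter>n. B n \<sigma>)"
    using S unfolding suslin_def by (elim exE conjE)
  have "B 0 \<sigma> \<subseteq> space M" for \<sigma> using suslin_schemeD(1)[OF B] by (rule sets.sets_into_space)
  then have "S \<subseteq> space M" unfolding S_eq by blast
  then obtain H where H: "H \<in> sets M" "S \<subseteq> H" "outer_measure_of M S = emeasure M H"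
    using outer_measure_of_attain by metis
  define \<T> where "\<T> = {T \<in> sets M. T \<subseteq> S}"
  have "\<T> \<noteq> {}" unfolding \<T>_def by auto
  then obtain f :: "nat \<Rightarrow> ennreal" where f: "range f \<subseteq> emeasure M ` \<T>"
    and SUP_f: "(SUP T\<in>\<T>. emeasure M T) = (SUP n. f n)"
    using ennreal_SUP_countable_SUP[of \<T> "emeasure M"] by auto
  have "\<forall>n. \<exists>T\<in>\<T>. f n = emeasure M T" using f by blast
  then obtain F where "\<And>n. F n \<in> \<T>" "\<And>n. f n = emeasure M (F n)" by metis
  with SUP_f have F: "range F \<subseteq> \<T>" "(SUP T\<in>\<T>. emeasure M T) = (SUP n. emeasure M (F n))" by auto
  define T where "T = (\<Union>n. F n)"
  have T: "T \<in> sets M" "T \<subseteq> S" using F(1) unfolding T_def \<T>_def by auto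
  have "emeasure M H \<le> emeasure M T"
  proof (rule dense_le)
    fix c assume "c < emeasure M H"
    then obtain T' where "T' \<in> \<T>" "c \<le> emeasure M T'"
      using suslin_inner_approx[OF S] H(3) unfolding \<T>_def by auto
    then have "c \<le> (SUP n. emeasure M (F n))" unfolding F(2)[symmetric] by (meson SUP_upper2)
    also have "\<dots> \<le> emeasure M T"
      using F(1) T(1) by (intro SUP_least emeasure_mono) (auto simp: T_def)
    finally show "c \<le> emeasure M T" .
  qed
  then have "emeasure M (H - T) = 0"
    using H T by (subst emeasure_Diff) (auto simp: diff_eq_0_iff_ennreal less_top[symmetric])
  then have "H - T \<in> null_sets M" using H T by auto
  moreover have "S = T \<union> (S - T)" "S - T \<subseteq> H - T" using H(2) T(2) by auto
  ultimately show ?thesis using T(1) by (intro sets_completionI[of S T "S - T" "H - T"])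
qed

text \<open>Suslin sets need not be closed under complement, so the sigma-algebra is made of sets
  that are Suslin together with their complement. It contains the generators because an open subset
  of the line is a countable union of compact sets.\<close>

lemma suslin_pair_measure:
  fixes M :: "'w measure" and S :: "('w \<times> real) set"
  assumes "S \<in> sets (M \<Otimes>\<^sub>M borel)"
  shows "suslin {A \<times> F | A F. A \<in> sets M \<and> closed F} S"
proof -
  let ?R = "{A \<times> F | A F. A \<in> sets M \<and> closed (F :: real set)}"
  let ?X = "space M \<times> (UNIV :: real set)"
  have X: "?X \<in> ?R" "\<And>A. A \<in> ?R \<Longrightarrow> A \<subseteq> ?X"
    by (auto dest: sets.sets_into_space)
  have Int: "A \<inter> B \<in> ?R" if "A \<in> ?R" "B \<in> ?R" for A B
  proof -
    from that(1) obtain A' F where "A = A' \<times> F" "A' \<in> sets M" "closed F" by blast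
    moreover from that(2) obtain B' G where "B = B' \<times> G" "B' \<in> sets M" "closed G" by blast
    moreover from calculation have "A \<inter> B = (A' \<inter> B') \<times> (F \<inter> G)" "A' \<inter> B' \<in> sets M" "closed (F \<inter> G)"
      by auto
    ultimately show ?thesis by blast
  qed
  note UN = suslin_UN[OF X] and INT = suslin_INT[OF X Int]
  define \<B> where "\<B> = {S. S \<subseteq> ?X \<and> suslin ?R S \<and> suslin ?R (?X - S)}"
  have "{} \<in> ?R" by auto
  have \<B>: "sigma_algebra ?X \<B>"
    unfolding sigma_algebra_iff2
  proof (intro conjI allI ballI impI)
    show "\<B> \<subseteq> Pow ?X" unfolding \<B>_def by blast
    show "{} \<in> \<B>" unfolding \<B>_def using \<open>{} \<in> ?R\<close> X(1) by (auto intro!: suslin_base)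
    show "?X - S \<in> \<B>" if "S \<in> \<B>" for S
      using that unfolding \<B>_def by (auto simp: double_diff)
    show "(\<Union>n. A n) \<in> \<B>" if "range A \<subseteq> \<B>" for A :: "nat \<Rightarrow> _"
    proof -
      have A: "A n \<subseteq> ?X" "suslin ?R (A n)" "suslin ?R (?X - A n)" for n
        using that unfolding \<B>_def by blast+
      have "?X - (\<Union>n. A n) = (\<Inter>n. ?X - A n)" by auto
      then show ?thesis using A UN[of A] INT[of "\<lambda>n. ?X - A n"] unfolding \<B>_def by auto
    qed
  qed
  interpret \<B>: sigma_algebra ?X \<B> by fact
  have left: "A \<times> UNIV \<in> \<B>" if "A \<in> sets M" for A
  proof -
    have "A \<times> UNIV \<in> ?R" "(space M - A) \<times> UNIV \<in> ?R" using that by blast+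
    moreover have "?X - A \<times> UNIV = (space M - A) \<times> UNIV" by auto
    ultimately show ?thesis unfolding \<B>_def using X by (auto intro!: suslin_base)
  qed
  have closed: "space M \<times> F \<in> \<B>" if "closed F" for F
  proof -
    have F: "space M \<times> F \<in> ?R" using that by blast
    have "open (- F)" using that by auto
    from open_Union_compact_subsets[OF this]
    obtain D :: "nat \<Rightarrow> real set" where D: "\<And>n. compact (D n)" "\<Union>(range D) = - F"
      by metis
    have "space M \<times> D n \<in> ?R" for n using compact_imp_closed[OF D(1)[of n]] by blast
    then have "suslin ?R (\<Union>n. space M \<times> D n)" by (intro UN suslin_base)
    moreover have "?X - space M \<times> F = (\<Union>n. space M \<times> D n)" using D(2) by auto
    ultimately show ?thesis unfolding \<B>_def using F X by (auto intro!: suslin_base)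
  qed
  have right: "space M \<times> C \<in> \<B>" if "C \<in> sets borel" for C
  proof -
    from that have "C \<in> sigma_sets UNIV (Collect closed)" by (simp add: borel_eq_closed)
    then show ?thesis
    proof induction
      case (Compl C)
      have "space M \<times> (UNIV - C) = ?X - space M \<times> C" by auto
      then show ?case using Compl by auto
    next
      case (Union C)
      have "space M \<times> (\<Union>i. C i) = (\<Union>i. space M \<times> C i)" by auto
      then show ?case using Union by auto
    qed (use closed in auto)
  qed
  have "A \<times> C \<in> \<B>" if "A \<in> sets M" "C \<in> sets borel" for A C
  proof -
    have "A \<times> C = (A \<times> UNIV) \<inter> (space M \<times> C)" using sets.sets_into_space[OF that(1)] by auto
    then show ?thesis using left right that by (metis \<B>.Int)
  qed
  then have "{A \<times> C | A C. A \<in> sets M \<and> C \<in> sets (borel :: real measure)} \<subseteq> \<B>" by blast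
  then have "sets (M \<Otimes>\<^sub>M borel) \<subseteq> \<B>"
    unfolding sets_pair_measure by (simp add: \<B>.sigma_sets_subset)
  then show ?thesis using assms unfolding \<B>_def by blast
qed

text \<open>Projection need not commute with intersections. Here the time sets of a branch are
  closed, so within a compact interval \<open>J\<close> they share a point as soon as all finite
  intersections are non-empty, and that is a condition on prefixes of the branch.\<close>

theorem (in finite_measure) measurable_projection:
  fixes S :: "('a \<times> real) set"
  assumes S: "S \<in> sets (M \<Otimes>\<^sub>M borel)"
  shows "fst ` S \<in> sets (completion M)"
proof -
  obtain B where B: "suslin_scheme {A \<times> F | A F. A \<in> sets M \<and> closed F} B"
    and S_eq: "S = (\<Union>\<sigma>. \<Inter>n. B n \<sigma>)"
    using suslin_pair_measure[OF S] unfolding suslin_def by (elim exE conjE)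
  define A where "A n \<sigma> = fst ` B n \<sigma>" for n \<sigma>
  define F where "F n \<sigma> = snd ` B n \<sigma>" for n \<sigma>
  have AF: "B n \<sigma> = A n \<sigma> \<times> F n \<sigma> \<and> A n \<sigma> \<in> sets M \<and> closed (F n \<sigma>)" for n \<sigma>
  proof -
    obtain A' F' where "B n \<sigma> = A' \<times> F'" "A' \<in> sets M" "closed F'"
      using suslin_schemeD(1)[OF B, of n \<sigma>] by auto
    \<comment> \<open>An empty rectangle does not determine its factors, but then both projections
      are empty, hence still measurable and closed.\<close>
    then show ?thesis unfolding A_def F_def by (cases "A' = {} \<or> F' = {}") auto
  qed
  have "suslin (sets M) (fst ` (S \<inter> UNIV \<times> {-real j..real j}))" for j
  proof -
    define J where "J = {-real j..real j}"
    define C where "C n \<sigma> = (if J \<inter> (\<Inter>m\<le>n. F m \<sigma>) = {} then {} else A n \<sigma>)" for n \<sigma>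
    have "suslin_scheme (sets M) C"
      unfolding suslin_scheme_def
    proof (intro conjI allI impI)
      show "C n \<sigma> \<in> sets M" for n \<sigma> using AF unfolding C_def by auto
      show "C n \<sigma> = C n \<tau>" if "\<forall>i<n. \<sigma> i = \<tau> i" for n \<sigma> \<tau>
      proof -
        have "B m \<sigma> = B m \<tau>" if "m \<le> n" for m
          using \<open>\<forall>i<n. \<sigma> i = \<tau> i\<close> that by (intro suslin_schemeD(2)[OF B]) auto
        then show ?thesis unfolding C_def A_def F_def by simp
      qed
    qed
    moreover have "fst ` (S \<inter> UNIV \<times> J) = (\<Union>\<sigma>. \<Inter>n. C n \<sigma>)"
    proof (intro equalityI subsetI)
      fix \<omega> assume "\<omega> \<in> fst ` (S \<inter> UNIV \<times> J)"
      then obtain t \<sigma> where t: "t \<in> J" "\<forall>n. (\<omega>, t) \<in> B n \<sigma>" unfolding S_eq by auto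
      then have "\<omega> \<in> A n \<sigma>" "t \<in> F n \<sigma>" for n using AF by blast+
      then have "\<omega> \<in> C n \<sigma>" for n unfolding C_def using t(1) by auto
      then show "\<omega> \<in> (\<Union>\<sigma>. \<Inter>n. C n \<sigma>)" by blast
    next
      fix \<omega> assume "\<omega> \<in> (\<Union>\<sigma>. \<Inter>n. C n \<sigma>)"
      then obtain \<sigma> where \<sigma>: "\<And>n. \<omega> \<in> C n \<sigma>" by blast
      have A: "\<omega> \<in> A n \<sigma>" and ne: "J \<inter> (\<Inter>m\<le>n. F m \<sigma>) \<noteq> {}" for n
        using \<sigma>[of n] unfolding C_def by (auto split: if_splits)
      have "J \<inter> (\<Inter>n. F n \<sigma>) \<noteq> {}"
      proof (rule compact_imp_fip_image)
        show "compact J" unfolding J_def by simp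
        show "closed (F n \<sigma>)" for n using AF by blast
        show "J \<inter> (\<Inter>n\<in>I. F n \<sigma>) \<noteq> {}" if "finite I" "I \<subseteq> UNIV" for I
        proof -
          have "(\<Inter>m\<le>Max I. F m \<sigma>) \<subseteq> (\<Inter>n\<in>I. F n \<sigma>)" using that(1) by auto
          then show ?thesis using ne[of "Max I"] by blast
        qed
      qed
      then obtain t where "t \<in> J" "\<And>n. t \<in> F n \<sigma>" by blast
      then have "(\<omega>, t) \<in> S \<inter> UNIV \<times> J" using A AF unfolding S_eq by auto
      then show "\<omega> \<in> fst ` (S \<inter> UNIV \<times> J)" by force
    qed
    ultimately show ?thesis unfolding suslin_def J_def by blast
  qed
  then have "(\<Union>j. fst ` (S \<inter> UNIV \<times> {-real j..real j})) \<in> sets (completion M)"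
    using suslin_completion by auto
  moreover have "fst ` S = (\<Union>j. fst ` (S \<inter> UNIV \<times> {-real j..real j}))"
  proof (intro equalityI subsetI)
    fix \<omega> assume "\<omega> \<in> fst ` S"
    then obtain t where t: "(\<omega>, t) \<in> S" by auto
    obtain j :: nat where "\<bar>t\<bar> \<le> real j" using real_arch_simple by blast
    then have "(\<omega>, t) \<in> S \<inter> UNIV \<times> {-real j..real j}" using t by auto
    then show "\<omega> \<in> (\<Union>j. fst ` (S \<inter> UNIV \<times> {-real j..real j}))" by force
  qed auto
  ultimately show ?thesis by simp
qed

section \<open>Distances and compact random sets\<close>

lemma dist_to_set_less_iff:
  "dist_to_set x A < ennreal e \<longleftrightarrow> (\<exists>a\<in>A. dist x a < e)"
  unfolding dist_to_set_def by (auto simp: INF_less_iff ennreal_less_iff)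

lemma dist_to_set_le: "a \<in> A \<Longrightarrow> dist_to_set x A \<le> ennreal (dist x a)"
  unfolding dist_to_set_def by (rule INF_lower)

lemma dist_to_set_empty [simp]: "dist_to_set x {} = \<top>"
  unfolding dist_to_set_def by simp

lemma dist_to_set_antimono: "A \<subseteq> B \<Longrightarrow> dist_to_set x B \<le> dist_to_set x A"
  unfolding dist_to_set_def by (rule INF_superset_mono) auto

lemma dist_to_set_attained:
  assumes "compact C" "C \<noteq> {}"
  obtains c where "c \<in> C" "dist_to_set x C = ennreal (dist x c)" "infdist x C = dist x c"
proof -
  have "continuous_on C (dist x)" by (intro continuous_intros)
  from continuous_attains_inf[OF assms this]
  obtain c where c: "c \<in> C" "\<And>y. y \<in> C \<Longrightarrow> dist x c \<le> dist x y" by auto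
  have "dist_to_set x C = ennreal (dist x c)"
    using c by (intro antisym dist_to_set_le) (auto simp: dist_to_set_def intro!: INF_greatest ennreal_leI)
  moreover have "infdist x C = dist x c"
    using c assms(2) by (intro antisym infdist_le) (auto simp: infdist_def intro!: cINF_greatest)
  ultimately show ?thesis using c(1) that by blast
qed

lemma dist_to_set_closure: "dist_to_set x (closure A) = dist_to_set x A"
proof (intro antisym)
  show "dist_to_set x (closure A) \<le> dist_to_set x A"
    by (intro dist_to_set_antimono closure_subset)
  have cont: "continuous_on UNIV (\<lambda>a. ennreal (dist x a))"
    by (intro continuous_on_ennreal continuous_intros)
  have "closed {a. dist_to_set x A \<le> ennreal (dist x a)}"
    by (intro closed_Collect_le continuous_on_const cont)
  moreover have "A \<subseteq> {a. dist_to_set x A \<le> ennreal (dist x a)}"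
    using dist_to_set_le by auto
  ultimately have "closure A \<subseteq> {a. dist_to_set x A \<le> ennreal (dist x a)}"
    by (rule closure_minimal[rotated])
  then show "dist_to_set x A \<le> dist_to_set x (closure A)"
    unfolding dist_to_set_def[of x "closure A"] by (intro INF_greatest) auto
qed

lemma closed_closed_nbhd:
  assumes "compact C" "0 \<le> \<delta>"
  shows "closed (closed_nbhd \<delta> C)"
proof (cases "C = {}")
  case False
  have "closed_nbhd \<delta> C = {x. infdist x C \<le> \<delta>}"
    unfolding closed_nbhd_def using dist_to_set_attained[OF assms(1) False] assms(2)
    by (metis (no_types, opaque_lifting) ennreal_le_iff)
  then show ?thesis by (simp add: closed_Collect_le continuous_on_infdist)
qed (simp add: closed_nbhd_def)

text \<open>Serves to replace a set by a countable dense subset in measurability arguments.\<close>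

lemma dense_subset_image:
  fixes g :: "'a::metric_space \<Rightarrow> 'b::metric_space"
  assumes g: "continuous_on UNIV g" and D: "D \<subseteq> B" "B \<subseteq> closure D"
  shows "closure (g ` D) = closure (g ` B)"
proof (rule antisym)
  show "closure (g ` D) \<subseteq> closure (g ` B)" using D(1) by (intro closure_mono image_mono)
  have "g ` closure D \<subseteq> closure (g ` D)"
    using g by (intro image_closure_subset closure_subset) (auto intro: continuous_on_subset)
  then show "closure (g ` B) \<subseteq> closure (g ` D)"
    using D(2) by (intro closure_minimal) auto
qed

lemma compact_image_closure:
  fixes g :: "'a::metric_space \<Rightarrow> 'b::metric_space"
  assumes g: "continuous_on UNIV g" and "compact (closure U)"
  shows "g ` closure U = closure (g ` U)"
proof (intro antisym image_closure_subset closure_subset closed_closure)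
  show "continuous_on (closure U) g" using g continuous_on_subset by blast
  have "compact (g ` closure U)" using assms by (meson compact_continuous_image continuous_on_subset subset_UNIV)
  then show "closure (g ` U) \<subseteq> g ` closure U"
    by (intro closure_minimal image_mono closure_subset compact_imp_closed)
qed

text \<open>Reverse Fatou for events: the tails \<open>T s\<close> decrease to the limsup and each
  has measure at least \<open>p\<close>. It yields recurrence in time as well as simultaneous
  control of countably many conditions.\<close>

lemma (in finite_measure) measure_infinitely_often:
  fixes G :: "nat \<Rightarrow> 'a set"
  assumes G: "\<And>n. G n \<in> sets M" and p: "\<And>n. p \<le> measure M (G n)"
  shows "p \<le> measure M {\<omega> \<in> space M. \<exists>\<^sub>\<infinity>n. \<omega> \<in> G n}"
    and "{\<omega> \<in> space M. \<exists>\<^sub>\<infinity>n. \<omega> \<in> G n} \<in> sets M"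
proof -
  define T where "T s = (\<Union>n\<in>{s..}. G n)" for s :: nat
  have T: "T s \<in> sets M" for s using G unfolding T_def by auto
  have eq: "{\<omega> \<in> space M. \<exists>\<^sub>\<infinity>n. \<omega> \<in> G n} = (\<Inter>s. T s)"
    using sets.sets_into_space[OF G] unfolding T_def INFM_nat_le by blast
  then show "{\<omega> \<in> space M. \<exists>\<^sub>\<infinity>n. \<omega> \<in> G n} \<in> sets M" using T by auto
  have "(\<lambda>s. measure M (T s)) \<longlonglongrightarrow> measure M (\<Inter>s. T s)"
    using T by (intro finite_Lim_measure_decseq) (auto simp: T_def decseq_def intro: order_trans)
  moreover have "p \<le> measure M (T s)" for s
    using T by (intro order_trans[OF p[of s]] finite_measure_mono) (auto simp: T_def)
  ultimately show "p \<le> measure M {\<omega> \<in> space M. \<exists>\<^sub>\<infinity>n. \<omega> \<in> G n}"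
    unfolding eq by (intro LIMSEQ_le_const) auto
qed

lemma (in prob_space) AE_ex_event:
  fixes G :: "nat \<Rightarrow> 'a set"
  assumes G: "\<And>m. G m \<in> events" and p: "\<And>m. p m \<le> prob (G m)" and lim: "p \<longlonglongrightarrow> 1"
  shows "AE \<omega> in M. \<exists>m. \<omega> \<in> G m"
proof -
  have "p m \<le> prob (\<Union>m. G m)" for m
    using G by (intro order_trans[OF p[of m]] finite_measure_mono) auto
  with lim have "1 \<le> prob (\<Union>m. G m)" by (intro LIMSEQ_le_const2) auto
  then have "AE \<omega> in M. \<omega> \<in> (\<Union>m. G m)"
    by (intro AE_prob_1 antisym) auto
  then show ?thesis by simp
qed

text \<open>\<open>measure\<close> is 0 on sets that are not measurable, so a positive lower bound
  forces \<open>S\<close> to be measurable for the completion; its \<open>main_part\<close> is an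
  event of the same measure.\<close>

lemma (in finite_measure) completion_inner_approx:
  assumes "0 < p" "p \<le> measure (completion M) S"
  shows "\<exists>G\<in>sets M. G \<subseteq> S \<and> p \<le> measure M G"
proof (intro bexI conjI)
  have S: "S \<in> sets (completion M)"
    using assms measure_notin_sets by fastforce
  then show "main_part M S \<subseteq> S" "main_part M S \<in> sets M"
    using main_part_null_part_Un by auto
  show "p \<le> measure M (main_part M S)"
    using assms(2) emeasure_completion[OF S] by (simp add: measure_def)
qed

text \<open>\<open>K \<omega>\<close> meets the open set \<open>-F\<close> iff it meets one of countably many balls in \<open>-F\<close>, which is
  an event expressed by \<open>dist_to_set\<close>.\<close>

lemma compact_random_set_subset_sets:
  fixes K :: "'w \<Rightarrow> 'e::polish_space set"
  assumes K: "compact_random_set M K" and F: "closed F"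
  shows "{\<omega> \<in> space M. K \<omega> \<subseteq> F} \<in> sets M"
proof -
  obtain D :: "'e set" where D: "countable D" "closure D = UNIV"
    by (rule separable[of UNIV]) auto
  define I where "I = {(q, n :: nat). q \<in> D \<and> ball q (inverse (Suc n)) \<inter> F = {}}"
  have "countable I"
    by (rule countable_subset[of _ "D \<times> UNIV"]) (auto simp: I_def D)
  have [measurable]: "(\<lambda>\<omega>. dist_to_set x (K \<omega>)) \<in> borel_measurable M" for x
    using K unfolding compact_random_set_def by blast
  have "K \<omega> \<subseteq> F \<longleftrightarrow> (\<forall>(q, n)\<in>I. \<not> dist_to_set q (K \<omega>) < ennreal (inverse (Suc n)))" for \<omega>
  proof
    show "\<forall>(q, n)\<in>I. \<not> dist_to_set q (K \<omega>) < ennreal (inverse (Suc n))" if "K \<omega> \<subseteq> F"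
      using that unfolding I_def dist_to_set_less_iff by (auto simp: disjoint_iff subset_iff)
    show "K \<omega> \<subseteq> F" if *: "\<forall>(q, n)\<in>I. \<not> dist_to_set q (K \<omega>) < ennreal (inverse (Suc n))"
    proof (rule ccontr)
      assume "\<not> K \<omega> \<subseteq> F"
      then obtain y where y: "y \<in> K \<omega>" "y \<notin> F" by blast
      then obtain e where e: "e > 0" "ball y e \<subseteq> - F"
        using F by (metis ComplI open_Compl open_contains_ball)
      obtain n where n: "inverse (Suc n) < e / 2" using e(1) reals_Archimedean[of "e/2"] by auto
      obtain q where q: "q \<in> D" "dist q y < inverse (Suc n)"
        using D(2) closure_approachable[of y D] by (metis UNIV_I inverse_positive_iff_positive of_nat_0_less_iff zero_less_Suc)
      have "ball q (inverse (Suc n)) \<subseteq> ball y e"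
      proof
        fix z assume "z \<in> ball q (inverse (Suc n))"
        then show "z \<in> ball y e" using dist_triangle[of y z q] q(2) n by (simp add: dist_commute)
      qed
      then have "(q, n) \<in> I" using e(2) q(1) unfolding I_def by auto
      moreover have "dist_to_set q (K \<omega>) < ennreal (inverse (Suc n))"
        unfolding dist_to_set_less_iff using y(1) q(2) by blast
      ultimately show False using * by blast
    qed
  qed
  then have "{\<omega> \<in> space M. K \<omega> \<subseteq> F} =
      {\<omega> \<in> space M. \<forall>i\<in>I. \<not> dist_to_set (fst i) (K \<omega>) < ennreal (inverse (Suc (snd i)))}"
    by (auto simp: case_prod_beta)
  also have "\<dots> \<in> sets M" using \<open>countable I\<close> by measurable
  finally show ?thesis .
qed

text \<open>Ulam's argument: for each \<open>n\<close>, finitely many closed balls of radius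
  \<open>1/(n+1)\<close> around points of a dense sequence catch \<open>K \<omega>\<close> with high
  probability. Intersecting over \<open>n\<close> gives a closed, totally bounded set.\<close>

lemma (in prob_space) compact_random_set_tight:
  fixes K :: "'a \<Rightarrow> 'e::polish_space set"
  assumes K: "compact_random_set M K" and \<epsilon>: "0 < \<epsilon>"
  shows "\<exists>C. compact C \<and> 1 - \<epsilon> \<le> prob {\<omega> \<in> space M. K \<omega> \<subseteq> C}"
proof -
  obtain D :: "'e set" where D: "countable D" "closure D = UNIV"
    by (rule separable[of UNIV]) auto
  then have "D \<noteq> {}" by auto
  define x where "x = from_nat_into D"
  have range_x: "range x = D" unfolding x_def using D(1) \<open>D \<noteq> {}\<close> by (rule range_from_nat_into[rotated])
  define F where "F n N = (\<Union>i\<le>N. cball (x i) (inverse (Suc n)))" for n N :: nat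
  define Ev where "Ev n N = {\<omega> \<in> space M. K \<omega> \<subseteq> F n N}" for n N
  have F_closed: "closed (F n N)" for n N unfolding F_def by auto
  have Ev[measurable]: "Ev n N \<in> events" for n N
    unfolding Ev_def using K F_closed by (rule compact_random_set_subset_sets)
  \<comment> \<open>The deficits \<open>\<epsilon> / 2^(n+1)\<close> add up to
    \<open>\<epsilon>\<close>.\<close>
  have "\<exists>N. 1 - \<epsilon> * (1/2) ^ Suc n < prob (Ev n N)" for n
  proof -
    have F_mono: "F n N \<subseteq> F n N'" if "N \<le> N'" for N N'
      unfolding F_def using that by (intro UN_mono) auto
    then have "incseq (Ev n)" unfolding incseq_def Ev_def by blast
    then have "(\<lambda>N. prob (Ev n N)) \<longlonglongrightarrow> prob (\<Union>N. Ev n N)"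
      by (intro finite_Lim_measure_incseq) auto
    moreover have "(\<Union>N. Ev n N) = space M"
    proof (intro antisym subsetI)
      fix \<omega> assume \<omega>: "\<omega> \<in> space M"
      have "\<exists>i. y \<in> ball (x i) (inverse (Suc n))" for y
        using D(2) closure_approachable[of y D] range_x by (metis UNIV_I imageE inverse_positive_iff_positive mem_ball of_nat_0_less_iff zero_less_Suc)
      then have "K \<omega> \<subseteq> (\<Union>i\<in>UNIV. ball (x i) (inverse (Suc n)))" by blast
      moreover have "compact (K \<omega>)" using K \<omega> unfolding compact_random_set_def by blast
      ultimately obtain I where I: "finite I" "K \<omega> \<subseteq> (\<Union>i\<in>I. ball (x i) (inverse (Suc n)))"
        using compactE_image[of "K \<omega>" UNIV "\<lambda>i. ball (x i) (inverse (Suc n))"] by (metis open_ball)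
      have "(\<Union>i\<in>I. ball (x i) (inverse (Suc n))) \<subseteq> F n (Max I)"
        unfolding F_def using I(1) by (intro UN_mono) (auto simp: less_imp_le)
      with I(2) have "K \<omega> \<subseteq> F n (Max I)" by (rule order_trans)
      then show "\<omega> \<in> (\<Union>N. Ev n N)" using \<omega> unfolding Ev_def by blast
    qed (auto simp: Ev_def)
    ultimately have "(\<lambda>N. prob (Ev n N)) \<longlonglongrightarrow> 1" by (simp add: prob_space)
    then have "eventually (\<lambda>N. 1 - \<epsilon> * (1/2) ^ Suc n < prob (Ev n N)) sequentially"
      using \<epsilon> by (intro order_tendstoD(1)) auto
    then show ?thesis by (auto simp: eventually_sequentially)
  qed
  then obtain N where N: "\<And>n. 1 - \<epsilon> * (1/2) ^ Suc n < prob (Ev n (N n))" by metis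
  define C where "C = (\<Inter>n. F n (N n))"
  have "closed C" unfolding C_def using F_closed by auto
  moreover have "\<exists>k. finite k \<and> C \<subseteq> (\<Union>y\<in>k. ball y e)" if "e > 0" for e
  proof -
    obtain n where n: "inverse (Suc n) < e" using reals_Archimedean[of e] \<open>e > 0\<close> by auto
    then have "cball (x i) (inverse (Suc n)) \<subseteq> ball (x i) e" for i by auto
    then have "C \<subseteq> (\<Union>y\<in>x ` {..N n}. ball y e)" unfolding C_def F_def by blast
    then show ?thesis by blast
  qed
  ultimately have "compact C" by (simp add: compact_eq_totally_bounded complete_eq_closed)
  moreover have "1 - \<epsilon> \<le> prob {\<omega> \<in> space M. K \<omega> \<subseteq> C}"
  proof -
    have *: "{\<omega> \<in> space M. K \<omega> \<subseteq> C} \<in> events"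
      using K \<open>closed C\<close> by (rule compact_random_set_subset_sets)
    have sums: "(\<lambda>n. \<epsilon> * (1/2) ^ Suc n) sums \<epsilon>"
      using sums_mult[OF power_half_series, of \<epsilon>] by simp
    have le: "prob (space M - Ev n (N n)) \<le> \<epsilon> * (1/2) ^ Suc n" for n
      using N[of n] by (simp add: prob_compl)
    have summable: "summable (\<lambda>n. prob (space M - Ev n (N n)))"
      by (intro summable_comparison_test'[OF sums_summable[OF sums], of 0])
        (simp only: real_norm_def abs_of_nonneg measure_nonneg le)
    have "space M - {\<omega> \<in> space M. K \<omega> \<subseteq> C} = (\<Union>n. space M - Ev n (N n))"
      unfolding C_def Ev_def by blast
    then have "1 - prob {\<omega> \<in> space M. K \<omega> \<subseteq> C} = prob (\<Union>n. space M - Ev n (N n))"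
      using prob_compl[OF *] by simp
    also have "\<dots> \<le> (\<Sum>n. prob (space M - Ev n (N n)))"
      by (intro finite_measure_subadditive_countably summable) auto
    also have "\<dots> \<le> \<epsilon>"
      using suminf_le[OF le summable sums_summable[OF sums]] sums_unique[OF sums] by simp
    finally show ?thesis by simp
  qed
  ultimately show ?thesis by blast
qed

section \<open>Pullback limit sets\<close>

context continuous_rds
begin

definition pullback :: "real \<Rightarrow> 'w \<Rightarrow> 'e \<Rightarrow> 'e" where
  "pullback t \<omega> x = \<phi> t (\<theta> (- t) \<omega>) x"

text \<open>Convergence to 0 is unfolded so that absorption by \<open>closed_nbhd \<delta> C\<close>
  becomes the single instance \<open>e = \<delta>\<close>.\<close>

definition attracted :: "'w \<Rightarrow> 'e set \<Rightarrow> 'e set \<Rightarrow> bool" where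
  "attracted \<omega> B C \<longleftrightarrow>
     (\<forall>e>0. \<forall>\<^sub>F t in at_top. \<forall>b\<in>B. dist_to_set (pullback t \<omega> b) C \<le> ennreal e)"

text \<open>With \<open>T = UNIV\<close> the meaningless negative times are harmless: only large \<open>s\<close> matter.\<close>

definition limit_set :: "real set \<Rightarrow> 'w \<Rightarrow> 'e set \<Rightarrow> 'e set" where
  "limit_set T \<omega> B = (\<Inter>s. closure (\<Union>t\<in>T \<inter> {s..}. pullback t \<omega> ` B))"

lemma shift_measurable_at [measurable]: "\<theta> t \<in> measurable M M"
proof -
  have "(\<lambda>\<omega>. (\<lambda>(\<omega>, t). \<theta> t \<omega>) (\<omega>, t)) \<in> measurable M M"
    by (intro measurable_compose[OF _ shift_measurable]) auto
  then show ?thesis by simp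
qed

lemma shift_space: "\<omega> \<in> space M \<Longrightarrow> \<theta> t \<omega> \<in> space M"
  using measurable_space[OF shift_measurable_at] .

lemma AE_shift: "AE \<omega> in M. P \<omega> \<Longrightarrow> AE \<omega> in M. P (\<theta> t \<omega>)"
  using AE_distrD[OF shift_measurable_at[of t], of P] by (simp only: shift_preserving)

lemma prob_shift: "A \<in> events \<Longrightarrow> prob (\<theta> t -` A \<inter> space M) = prob A"
  using measure_distr[OF shift_measurable_at, of A t] by (simp add: shift_preserving)

text \<open>The cocycle is measurable on times \<open>t \<ge> 0\<close> only; \<open>max 0 t\<close>
  extends it to the whole line, over which the projection theorem is stated.\<close>

lemma pullback_measurable_pair:
  "(\<lambda>(\<omega>, t). pullback (max 0 t) \<omega> x) \<in> M \<Otimes>\<^sub>M borel \<rightarrow>\<^sub>M borel"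
proof -
  have "(\<lambda>p. (\<lambda>(\<omega>, t). \<theta> t \<omega>) (fst p, - max 0 (snd p))) \<in> M \<Otimes>\<^sub>M borel \<rightarrow>\<^sub>M M"
    by (rule measurable_compose[OF _ shift_measurable]) measurable
  then have shift: "(\<lambda>p. \<theta> (- max 0 (snd p)) (fst p)) \<in> M \<Otimes>\<^sub>M borel \<rightarrow>\<^sub>M M" by simp
  have "(\<lambda>p. max 0 (snd p)) \<in> M \<Otimes>\<^sub>M borel \<rightarrow>\<^sub>M restrict_space borel {0 :: real..}"
    by (rule measurable_restrict_space2) auto
  then have "(\<lambda>p. (max 0 (snd p), x, \<theta> (- max 0 (snd p)) (fst p)))
      \<in> M \<Otimes>\<^sub>M borel \<rightarrow>\<^sub>M restrict_space borel {0..} \<Otimes>\<^sub>M (borel \<Otimes>\<^sub>M M)"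
    by (intro measurable_Pair measurable_const shift) simp_all
  from measurable_compose[OF this cocycle_measurable]
  show ?thesis by (simp add: case_prod_beta pullback_def)
qed

lemma pullback_measurable:
  assumes "0 \<le> t"
  shows "(\<lambda>\<omega>. pullback t \<omega> x) \<in> borel_measurable M"
proof -
  have "(\<lambda>\<omega>. (\<lambda>(\<omega>, t). pullback (max 0 t) \<omega> x) (\<omega>, t)) \<in> borel_measurable M"
    by (intro measurable_compose[OF _ pullback_measurable_pair]) auto
  then show ?thesis using assms by simp
qed

lemma pullback_continuous: "\<omega> \<in> space M \<Longrightarrow> 0 \<le> t \<Longrightarrow> continuous_on UNIV (pullback t \<omega>)"
  unfolding pullback_def using cocycle_continuous shift_space by blast

text \<open>Both sides follow the same orbit: it starts over \<open>\<theta> (- t) \<omega>\<close>,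
  is over \<open>\<omega>\<close> after time \<open>t\<close> and over
  \<open>\<theta> s \<omega>\<close> after a further time \<open>s\<close>.\<close>

lemma pullback_shift:
  assumes "\<omega> \<in> space M" "0 \<le> s" "0 \<le> t"
  shows "pullback (t + s) (\<theta> s \<omega>) x = \<phi> s \<omega> (pullback t \<omega> x)"
proof -
  have "\<theta> (- (t + s)) (\<theta> s \<omega>) = \<theta> (- t) \<omega>" "\<theta> t (\<theta> (- t) \<omega>) = \<omega>"
    using shift_add[of \<omega> "- (t + s)" s] shift_add[of \<omega> t "- t"] shift_zero assms by auto
  then show ?thesis
    using cocycle_add[of "\<theta> (- t) \<omega>" t s x] shift_space assms unfolding pullback_def
    by (simp add: add.commute)
qed

lemma attracted_iff_tendsto:
  "attracted \<omega> B C \<longleftrightarrow> ((\<lambda>t. SUP x\<in>B. dist_to_set (\<phi> t (\<theta> (- t) \<omega>) x) C) \<longlongrightarrow> 0) at_top"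
proof
  assume attr: "attracted \<omega> B C"
  show "((\<lambda>t. SUP x\<in>B. dist_to_set (\<phi> t (\<theta> (- t) \<omega>) x) C) \<longlongrightarrow> 0) at_top"
  proof (rule order_tendstoI)
    fix a :: ennreal assume "0 < a"
    then obtain b where b: "0 < b" "b < a" using dense by blast
    then obtain e where e: "b = ennreal e" "0 < e"
      by (metis ennreal_cases ennreal_less_zero_iff not_less_iff_gr_or_eq top_greatest leD)
    from attr e(2) have "\<forall>\<^sub>F t in at_top. \<forall>b\<in>B. dist_to_set (pullback t \<omega> b) C \<le> ennreal e"
      unfolding attracted_def by blast
    then show "\<forall>\<^sub>F t in at_top. (SUP x\<in>B. dist_to_set (\<phi> t (\<theta> (- t) \<omega>) x) C) < a"
    proof eventually_elim
      case (elim t)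
      then have "(SUP x\<in>B. dist_to_set (\<phi> t (\<theta> (- t) \<omega>) x) C) \<le> b"
        unfolding pullback_def e by (intro SUP_least) blast
      then show ?case using b(2) by (rule le_less_trans)
    qed
  qed simp
next
  assume lim: "((\<lambda>t. SUP x\<in>B. dist_to_set (\<phi> t (\<theta> (- t) \<omega>) x) C) \<longlongrightarrow> 0) at_top"
  show "attracted \<omega> B C"
    unfolding attracted_def
  proof (intro allI impI)
    fix e :: real assume "0 < e"
    then have "\<forall>\<^sub>F t in at_top. (SUP x\<in>B. dist_to_set (\<phi> t (\<theta> (- t) \<omega>) x) C) < ennreal e"
      by (intro order_tendstoD(2)[OF lim]) auto
    then show "\<forall>\<^sub>F t in at_top. \<forall>b\<in>B. dist_to_set (pullback t \<omega> b) C \<le> ennreal e"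
    proof eventually_elim
      case (elim t)
      then show ?case unfolding pullback_def by (meson SUP_upper le_less_trans less_imp_le)
    qed
  qed
qed

lemma strongly_attracts_iff:
  "strongly_attracts M \<theta> \<phi> K B \<longleftrightarrow> (AE \<omega> in M. attracted \<omega> B (K \<omega>))"
  unfolding strongly_attracts_def attracted_iff_tendsto excess_def by (simp add: image_image)

lemma mem_absorption_event_iff:
  "\<omega> \<in> absorption_event M \<theta> \<phi> B (closed_nbhd \<delta> C) \<longleftrightarrow>
     \<omega> \<in> space M \<and> (\<forall>\<^sub>F t in at_top. \<forall>b\<in>B. dist_to_set (pullback t \<omega> b) C \<le> ennreal \<delta>)"
proof -
  have "(\<forall>\<^sub>F t in at_top. \<forall>b\<in>B. dist_to_set (pullback t \<omega> b) C \<le> ennreal \<delta>) \<longleftrightarrow>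
      (\<exists>s\<ge>0. \<forall>t\<ge>s. \<forall>b\<in>B. dist_to_set (pullback t \<omega> b) C \<le> ennreal \<delta>)"
    unfolding eventually_at_top_linorder by (meson max.cobounded1 max.cobounded2 order_trans)
  also have "\<dots> \<longleftrightarrow> (\<exists>s\<ge>0. B \<subseteq> (\<Inter>t\<in>{s..}. \<phi> t (\<theta> (- t) \<omega>) -` closed_nbhd \<delta> C))"
    unfolding closed_nbhd_def pullback_def by (auto simp: subset_iff)
  finally show ?thesis unfolding absorption_event_def by blast
qed

lemma attracted_mono: "attracted \<omega> B C \<Longrightarrow> B' \<subseteq> B \<Longrightarrow> C \<subseteq> C' \<Longrightarrow> attracted \<omega> B' C'"
  unfolding attracted_def
  by (elim all_forward imp_forward2 eventually_mono) (auto intro: order_trans[OF dist_to_set_antimono])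

text \<open>The only source of compactness in \<open>E\<close>: nearest points of \<open>C\<close>
  have a convergent subsequence, and the distances to them tend to 0.\<close>

lemma attracted_subseq:
  assumes attr: "attracted \<omega> B C" and C: "compact C"
    and t: "filterlim t at_top sequentially" and b: "\<And>n::nat. b n \<in> B"
  obtains r x where "strict_mono r" "x \<in> C" "(\<lambda>n. pullback (t (r n)) \<omega> (b (r n))) \<longlonglongrightarrow> x"
proof -
  define y where "y n = pullback (t n) \<omega> (b n)" for n
  have small: "\<forall>\<^sub>F n in sequentially. dist_to_set (y n) C \<le> ennreal e" if "0 < e" for e
  proof -
    have "\<forall>\<^sub>F t in at_top. \<forall>b\<in>B. dist_to_set (pullback t \<omega> b) C \<le> ennreal e"
      using attr that unfolding attracted_def by blast
    then have "\<forall>\<^sub>F n in sequentially. \<forall>b\<in>B. dist_to_set (pullback (t n) \<omega> b) C \<le> ennreal e"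
      using t by (rule eventually_compose_filterlim)
    then show ?thesis by eventually_elim (use b in \<open>auto simp: y_def\<close>)
  qed
  \<comment> \<open>The convention that the distance to the empty set is infinite enters here:
    nothing non-empty is attracted by \<open>{}\<close>.\<close>
  have "C \<noteq> {}"
  proof
    assume "C = {}"
    with small[of 1] have "\<forall>\<^sub>F n in sequentially. False" by (simp add: top_unique)
    then show False by simp
  qed
  then have "\<exists>c\<in>C. dist_to_set (y n) C = ennreal (dist (y n) c)" for n
    by (meson dist_to_set_attained[OF C])
  then obtain c where c: "\<And>n. c n \<in> C" "\<And>n. dist_to_set (y n) C = ennreal (dist (y n) (c n))"
    by metis
  have dist0: "(\<lambda>n. dist (c n) (y n)) \<longlonglongrightarrow> 0"
  proof (rule order_tendstoI)
    fix a :: real assume "0 < a"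
    then have "\<forall>\<^sub>F n in sequentially. dist_to_set (y n) C \<le> ennreal (a / 2)" by (intro small) simp
    then show "\<forall>\<^sub>F n in sequentially. dist (c n) (y n) < a"
      by eventually_elim (use \<open>0 < a\<close> in \<open>simp add: c(2) dist_commute\<close>)
  qed (simp add: less_le_trans[OF _ zero_le_dist])
  obtain x r where r: "x \<in> C" "strict_mono r" "(c \<circ> r) \<longlonglongrightarrow> x"
    using C c(1) unfolding compact_def by blast
  have "(\<lambda>n. dist (c (r n)) (y (r n))) \<longlonglongrightarrow> 0"
    using LIMSEQ_subseq_LIMSEQ[OF dist0 r(2)] by (simp add: comp_def)
  moreover have "(\<lambda>n. dist (c (r n)) x) \<longlonglongrightarrow> 0"
    using r(3) by (simp add: tendsto_dist_iff[of _ x] comp_def)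
  ultimately have "(\<lambda>n. dist (c (r n)) (y (r n)) + dist (c (r n)) x) \<longlonglongrightarrow> 0"
    by (rule tendsto_add_zero)
  then have "(\<lambda>n. dist (y (r n)) x) \<longlonglongrightarrow> 0"
    by (rule tendsto_sandwich[OF _ _ tendsto_const, rotated 2])
      (simp_all add: dist_triangle3)
  then have "(\<lambda>n. y (r n)) \<longlonglongrightarrow> x"
    by (simp add: tendsto_dist_iff[of _ x])
  then show ?thesis using that r(1,2) unfolding y_def by blast
qed

section \<open>Limit sets: characterization by sequences, attraction and invariance\<close>

lemma limit_setD:
  assumes "x \<in> limit_set T \<omega> B"
  shows "\<exists>t b. (\<forall>n::nat. t n \<in> T \<and> b n \<in> B) \<and> filterlim t at_top sequentially \<and>
    (\<lambda>n. pullback (t n) \<omega> (b n)) \<longlonglongrightarrow> x"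
proof -
  have "\<exists>t b. t \<in> T \<and> real n \<le> t \<and> b \<in> B \<and> dist (pullback t \<omega> b) x < inverse (Suc n)" for n
  proof -
    have "x \<in> closure (\<Union>t\<in>T \<inter> {real n..}. pullback t \<omega> ` B)"
      using assms unfolding limit_set_def by blast
    then show ?thesis unfolding closure_approachable by (force dest: spec[of _ "inverse (real (Suc n))"])
  qed
  then obtain t b where tb: "\<And>n. t n \<in> T" "\<And>n. real n \<le> t n" "\<And>n. b n \<in> B"
    "\<And>n. dist (pullback (t n) \<omega> (b n)) x < inverse (Suc n)"
    by metis
  have "filterlim t at_top sequentially"
    using tb(2) by (intro filterlim_at_top_mono[OF filterlim_real_sequentially]) auto
  moreover have "(\<lambda>n. pullback (t n) \<omega> (b n)) \<longlonglongrightarrow> x"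
    unfolding tendsto_dist_iff[of _ x]
    using tb(4) less_imp_le
    by (intro real_tendsto_sandwich[OF _ _ tendsto_const LIMSEQ_inverse_real_of_nat]) (auto intro!: always_eventually)
  ultimately show ?thesis using tb(1,3) by blast
qed

lemma limit_setI:
  assumes "\<And>n::nat. t n \<in> T" "\<And>n. b n \<in> B" "filterlim t at_top sequentially"
    "(\<lambda>n. pullback (t n) \<omega> (b n)) \<longlonglongrightarrow> x"
  shows "x \<in> limit_set T \<omega> B"
  unfolding limit_set_def
proof
  fix s
  have "\<forall>\<^sub>F n in sequentially. s \<le> t n" using assms(3) by (simp add: filterlim_at_top)
  then have "\<forall>\<^sub>F n in sequentially. pullback (t n) \<omega> (b n) \<in> closure (\<Union>t\<in>T \<inter> {s..}. pullback t \<omega> ` B)"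
    by eventually_elim (use assms(1,2) in \<open>auto intro!: subsetD[OF closure_subset]\<close>)
  then show "x \<in> closure (\<Union>t\<in>T \<inter> {s..}. pullback t \<omega> ` B)"
    using assms(4) by (intro Lim_in_closed_set) auto
qed

lemma limit_set_mono: "T \<subseteq> T' \<Longrightarrow> B \<subseteq> B' \<Longrightarrow> limit_set T \<omega> B \<subseteq> limit_set T' \<omega> B'"
  unfolding limit_set_def by (intro INF_mono' closure_mono UN_mono image_mono) auto

lemma limit_set_subset:
  assumes attr: "attracted \<omega> B C" and C: "compact C"
  shows "limit_set T \<omega> B \<subseteq> C"
proof
  fix x assume "x \<in> limit_set T \<omega> B"
  from limit_setD[OF this] obtain t b where tb: "\<And>n::nat. b n \<in> B"
    "filterlim t at_top sequentially" "(\<lambda>n. pullback (t n) \<omega> (b n)) \<longlonglongrightarrow> x" by blast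
  from attracted_subseq[OF attr C tb(2,1)]
  obtain r y where r: "strict_mono r" "y \<in> C" "(\<lambda>n. pullback (t (r n)) \<omega> (b (r n))) \<longlonglongrightarrow> y" .
  have "(\<lambda>n. pullback (t (r n)) \<omega> (b (r n))) \<longlonglongrightarrow> x"
    using LIMSEQ_subseq_LIMSEQ[OF tb(3) r(1)] by (simp add: comp_def)
  with r(3) have "x = y" by (rule LIMSEQ_unique[rotated])
  with r(2) show "x \<in> C" by simp
qed

text \<open>Otherwise orbit points at arbitrarily late times would stay \<open>e\<close>-away from
  the limit set, yet by \<open>attracted_subseq\<close> they accumulate at a point of it.\<close>

lemma attracted_limit_set:
  assumes attr: "attracted \<omega> B C" and C: "compact C"
  shows "attracted \<omega> B (limit_set UNIV \<omega> B)"
proof (rule ccontr)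
  let ?L = "limit_set UNIV \<omega> B"
  assume "\<not> attracted \<omega> B ?L"
  then obtain e where e: "0 < e"
    "\<not> (\<forall>\<^sub>F t in at_top. \<forall>b\<in>B. dist_to_set (pullback t \<omega> b) ?L \<le> ennreal e)"
    unfolding attracted_def by blast
  from e(2) have "\<exists>t b. real n \<le> t \<and> b \<in> B \<and> \<not> dist_to_set (pullback t \<omega> b) ?L \<le> ennreal e" for n
    unfolding eventually_at_top_linorder by blast
  then obtain t b where tb: "\<And>n. real n \<le> t n" "\<And>n. b n \<in> B"
    "\<And>n. \<not> dist_to_set (pullback (t n) \<omega> (b n)) ?L \<le> ennreal e" by metis
  have t: "filterlim t at_top sequentially"
    using tb(1) by (intro filterlim_at_top_mono[OF filterlim_real_sequentially]) auto
  from attracted_subseq[OF attr C t tb(2)]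
  obtain r x where r: "strict_mono r" "x \<in> C" "(\<lambda>n. pullback (t (r n)) \<omega> (b (r n))) \<longlonglongrightarrow> x" .
  have "filterlim (\<lambda>n. t (r n)) at_top sequentially"
    using filterlim_compose[OF t filterlim_subseq[OF r(1)]] .
  then have "x \<in> ?L" using r(3) tb(2) by (intro limit_setI[where t="\<lambda>n. t (r n)" and b="\<lambda>n. b (r n)"]) auto
  moreover have "\<forall>\<^sub>F n in sequentially. dist (pullback (t (r n)) \<omega> (b (r n))) x < e"
    using r(3) e(1) by (rule tendstoD)
  then obtain n where "dist (pullback (t (r n)) \<omega> (b (r n))) x < e"
    by (auto simp: eventually_sequentially)
  ultimately have "dist_to_set (pullback (t (r n)) \<omega> (b (r n))) ?L \<le> ennreal e"
    using dist_to_set_less_iff less_imp_le by blast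
  with tb(3) show False by blast
qed

lemma limit_set_nonempty:
  assumes "attracted \<omega> B C" "compact C" "B \<noteq> {}"
  shows "limit_set \<nat> \<omega> B \<noteq> {}"
proof -
  from assms(3) obtain b where b: "b \<in> B" by blast
  from attracted_subseq[OF assms(1,2) filterlim_real_sequentially, of "\<lambda>_. b", OF b]
  obtain r x where r: "strict_mono r" "x \<in> C" "(\<lambda>n. pullback (real (r n)) \<omega> b) \<longlonglongrightarrow> x" .
  have "filterlim (\<lambda>n. real (r n)) at_top sequentially"
    using filterlim_compose[OF filterlim_real_sequentially filterlim_subseq[OF r(1)]] .
  then have "x \<in> limit_set \<nat> \<omega> B"
    using b r(3) by (intro limit_setI[where t="\<lambda>n. real (r n)" and b="\<lambda>_. b"]) auto
  then show ?thesis by blast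
qed

lemma limit_set_image_subset:
  assumes \<omega>: "\<omega> \<in> space M" and s: "0 \<le> s"
  shows "\<phi> s \<omega> ` limit_set UNIV \<omega> B \<subseteq> limit_set UNIV (\<theta> s \<omega>) B"
proof
  fix z assume "z \<in> \<phi> s \<omega> ` limit_set UNIV \<omega> B"
  then obtain x where z: "z = \<phi> s \<omega> x" and x: "x \<in> limit_set UNIV \<omega> B" by blast
  from limit_setD[OF x] obtain t b where tb: "\<And>n::nat. b n \<in> B" "filterlim t at_top sequentially"
    "(\<lambda>n. pullback (t n) \<omega> (b n)) \<longlonglongrightarrow> x" by blast
  have "(\<lambda>n. \<phi> s \<omega> (pullback (t n) \<omega> (b n))) \<longlonglongrightarrow> z"
    unfolding z using cocycle_continuous[OF \<omega> s] tb(3)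
    by (intro isCont_tendsto_compose[of x "\<phi> s \<omega>"]) (simp_all add: continuous_on_eq_continuous_at)
  moreover have "\<forall>\<^sub>F n in sequentially. 0 \<le> t n" using tb(2) by (simp add: filterlim_at_top)
  then have "\<forall>\<^sub>F n in sequentially. \<phi> s \<omega> (pullback (t n) \<omega> (b n)) = pullback (t n + s) (\<theta> s \<omega>) (b n)"
    by eventually_elim (simp add: pullback_shift \<omega> s)
  ultimately have "(\<lambda>n. pullback (t n + s) (\<theta> s \<omega>) (b n)) \<longlonglongrightarrow> z"
    by (rule Lim_transform_eventually)
  moreover have "filterlim (\<lambda>n. t n + s) at_top sequentially"
    using filterlim_tendsto_add_at_top[OF tendsto_const tb(2), of s] by (simp add: add.commute)
  ultimately show "z \<in> limit_set UNIV (\<theta> s \<omega>) B"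
    using tb(1) by (intro limit_setI[where t="\<lambda>n. t n + s" and b=b]) auto
qed

text \<open>A limit point over \<open>\<theta> s \<omega>\<close> is approached by images under
  \<open>\<phi> s \<omega>\<close> of pullbacks to \<open>\<omega>\<close> at times
  \<open>t n - s\<close>. Attraction over \<open>\<omega>\<close> makes these accumulate, and
  continuity carries the accumulation point to \<open>z\<close>.\<close>

lemma limit_set_subset_image:
  assumes \<omega>: "\<omega> \<in> space M" and s: "0 \<le> s" and attr: "attracted \<omega> B C" and C: "compact C"
  shows "limit_set UNIV (\<theta> s \<omega>) B \<subseteq> \<phi> s \<omega> ` limit_set UNIV \<omega> B"
proof
  fix z assume "z \<in> limit_set UNIV (\<theta> s \<omega>) B"
  from limit_setD[OF this] obtain t b where tb: "\<And>n::nat. b n \<in> B" "filterlim t at_top sequentially"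
    "(\<lambda>n. pullback (t n) (\<theta> s \<omega>) (b n)) \<longlonglongrightarrow> z" by blast
  have t': "filterlim (\<lambda>n. t n - s) at_top sequentially"
    using filterlim_tendsto_add_at_top[OF tendsto_const tb(2), of "- s"] by simp
  from attracted_subseq[OF attr C t' tb(1)]
  obtain r x where r: "strict_mono r" "x \<in> C" "(\<lambda>n. pullback (t (r n) - s) \<omega> (b (r n))) \<longlonglongrightarrow> x" .
  have t'': "filterlim (\<lambda>n. t (r n) - s) at_top sequentially"
    using filterlim_compose[OF t' filterlim_subseq[OF r(1)]] .
  have "(\<lambda>n. \<phi> s \<omega> (pullback (t (r n) - s) \<omega> (b (r n)))) \<longlonglongrightarrow> \<phi> s \<omega> x"
    using cocycle_continuous[OF \<omega> s] r(3)
    by (intro isCont_tendsto_compose[of x "\<phi> s \<omega>"]) (simp_all add: continuous_on_eq_continuous_at)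
  moreover have "\<forall>\<^sub>F n in sequentially. 0 \<le> t (r n) - s" using t'' by (simp only: filterlim_at_top)
  then have "\<forall>\<^sub>F n in sequentially.
      \<phi> s \<omega> (pullback (t (r n) - s) \<omega> (b (r n))) = pullback (t (r n)) (\<theta> s \<omega>) (b (r n))"
  proof eventually_elim
    case (elim n)
    then show ?case using pullback_shift[OF \<omega> s, of "t (r n) - s"] by simp
  qed
  ultimately have "(\<lambda>n. pullback (t (r n)) (\<theta> s \<omega>) (b (r n))) \<longlonglongrightarrow> \<phi> s \<omega> x"
    by (rule Lim_transform_eventually)
  moreover have "(\<lambda>n. pullback (t (r n)) (\<theta> s \<omega>) (b (r n))) \<longlonglongrightarrow> z"
    using LIMSEQ_subseq_LIMSEQ[OF tb(3) r(1)] by (simp add: comp_def)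
  ultimately have "z = \<phi> s \<omega> x" by (rule LIMSEQ_unique[rotated])
  moreover have "x \<in> limit_set UNIV \<omega> B"
    using t'' r(3) tb(1) by (intro limit_setI[where t="\<lambda>n. t (r n) - s" and b="\<lambda>n. b (r n)"]) auto
  ultimately show "z \<in> \<phi> s \<omega> ` limit_set UNIV \<omega> B" by blast
qed

text \<open>By invariance a point of the limit set of \<open>B\<close> is, for each such \<open>n\<close>, the image at time \<open>n\<close> of
  a point of the limit set at \<open>\<theta> (- n) \<omega>\<close>, which lies in \<open>C\<close>.\<close>

lemma limit_set_recurrent:
  assumes \<omega>: "\<omega> \<in> space M" and C: "compact C"
    and rec: "\<exists>\<^sub>\<infinity>n. attracted (\<theta> (- real n) \<omega>) B C"
  shows "limit_set UNIV \<omega> B \<subseteq> limit_set \<nat> \<omega> C"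
proof
  fix x assume x: "x \<in> limit_set UNIV \<omega> B"
  show "x \<in> limit_set \<nat> \<omega> C"
    unfolding limit_set_def
  proof
    fix s :: real
    obtain n where n: "nat \<lceil>s\<rceil> \<le> n" "attracted (\<theta> (- real n) \<omega>) B C"
      using rec unfolding INFM_nat_le by blast
    have "\<theta> (real n) (\<theta> (- real n) \<omega>) = \<omega>"
      using shift_add[OF \<omega>, of "real n" "- real n"] shift_zero[OF \<omega>] by simp
    with x limit_set_subset_image[OF shift_space[OF \<omega>] _ n(2) C, of "real n"]
    have "x \<in> \<phi> n (\<theta> (- real n) \<omega>) ` limit_set UNIV (\<theta> (- real n) \<omega>) B" by auto
    then have "x \<in> pullback n \<omega> ` C"
      using limit_set_subset[OF n(2) C] unfolding pullback_def by blast
    moreover have "real n \<in> \<nat> \<inter> {s..}" using n(1) by (auto simp: nat_le_iff ceiling_le_iff)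
    ultimately show "x \<in> closure (\<Union>t\<in>\<nat> \<inter> {s..}. pullback t \<omega> ` C)"
      by (blast intro: subsetD[OF closure_subset])
  qed
qed

text \<open>Expresses the distance by countably many pullbacks, from which measurability follows.
  The distance to a decreasing intersection can exceed the supremum of the distances to its members;
  attraction by the compact \<open>C\<close> excludes this.\<close>

lemma dist_to_set_limit_set:
  assumes \<omega>: "\<omega> \<in> space M" and attr: "attracted \<omega> B C" and C: "compact C"
    and D: "D \<subseteq> B" "B \<subseteq> closure D"
  shows "dist_to_set x (limit_set \<nat> \<omega> B) =
    (SUP s. INF n\<in>{s::nat..}. INF b\<in>D. ennreal (dist x (pullback n \<omega> b)))"
proof -
  have INF_eq: "(INF b\<in>D. ennreal (dist x (pullback n \<omega> b))) = dist_to_set x (pullback n \<omega> ` B)" for n :: nat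
  proof -
    have "dist_to_set x (pullback n \<omega> ` D) = dist_to_set x (pullback n \<omega> ` B)"
      using dense_subset_image[OF pullback_continuous[OF \<omega>] D, of n] dist_to_set_closure
      by (metis of_nat_0_le_iff)
    then show ?thesis by (simp add: dist_to_set_def image_image)
  qed
  let ?tail = "\<lambda>s. \<Union>n\<in>{s::nat..}. pullback (real n) \<omega> ` B"
  have tail_eq: "(INF n\<in>{s..}. INF b\<in>D. ennreal (dist x (pullback n \<omega> b))) = dist_to_set x (?tail s)" for s :: nat
    unfolding INF_eq dist_to_set_def
    by (intro antisym INF_greatest) (auto intro: INF_lower2 INF_lower)
  let ?L = "SUP s. dist_to_set x (?tail s)"
  have "dist_to_set x (limit_set \<nat> \<omega> B) = ?L"
  proof (rule antisym)
    show "?L \<le> dist_to_set x (limit_set \<nat> \<omega> B)"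
    proof (rule SUP_least)
      fix s :: nat
      have "(\<Union>t\<in>\<nat> \<inter> {real s..}. pullback t \<omega> ` B) \<subseteq> ?tail s"
        by (auto simp: Nats_def)
      then have "limit_set \<nat> \<omega> B \<subseteq> closure (?tail s)"
        unfolding limit_set_def by (meson INF_lower2 UNIV_I closure_mono)
      then show "dist_to_set x (?tail s) \<le> dist_to_set x (limit_set \<nat> \<omega> B)"
        using dist_to_set_antimono dist_to_set_closure by metis
    qed
    show "dist_to_set x (limit_set \<nat> \<omega> B) \<le> ?L"
    proof (cases ?L)
      case (real l)
      \<comment> \<open>Nearly optimal points in later and later tails; their accumulation point
        lies in the limit set at distance at most \<open>l\<close>.\<close>
      have "\<exists>n b. s \<le> n \<and> b \<in> B \<and> dist x (pullback (real n) \<omega> b) < l + inverse (Suc s)" for s :: nat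
      proof -
        have "dist_to_set x (?tail s) \<le> ennreal l" unfolding real(2)[symmetric] by (rule SUP_upper) simp
        also have "\<dots> < ennreal (l + inverse (Suc s))" using real(1) by (intro ennreal_lessI add_nonneg_pos) auto
        finally show ?thesis unfolding dist_to_set_less_iff by auto
      qed
      then obtain n b where nb: "\<And>s. s \<le> n s" "\<And>s. b s \<in> B"
        "\<And>s. dist x (pullback (real (n s)) \<omega> (b s)) < l + inverse (Suc s)" by metis
      have n: "filterlim (\<lambda>s. real (n s)) at_top sequentially"
        using nb(1) by (intro filterlim_at_top_mono[OF filterlim_real_sequentially]) auto
      from attracted_subseq[OF attr C n nb(2)]
      obtain r y where r: "strict_mono r" "y \<in> C" "(\<lambda>i. pullback (real (n (r i))) \<omega> (b (r i))) \<longlonglongrightarrow> y" .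
      have "filterlim (\<lambda>i. real (n (r i))) at_top sequentially"
        using filterlim_compose[OF n filterlim_subseq[OF r(1)]] .
      then have y: "y \<in> limit_set \<nat> \<omega> B"
        using r(3) nb(2) by (intro limit_setI[where t="\<lambda>i. real (n (r i))" and b="\<lambda>i. b (r i)"]) auto
      have "(\<lambda>i. l + inverse (real (Suc (r i)))) \<longlonglongrightarrow> l"
        using tendsto_add[OF tendsto_const LIMSEQ_subseq_LIMSEQ[OF LIMSEQ_inverse_real_of_nat r(1)], of l]
        by (simp add: comp_def)
      moreover have "(\<lambda>i. dist x (pullback (real (n (r i))) \<omega> (b (r i)))) \<longlonglongrightarrow> dist x y"
        by (intro tendsto_intros r(3))
      ultimately have "dist x y \<le> l"
        using nb(3) less_imp_le by (intro LIMSEQ_le[of _ "dist x y" _ l]) blast+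
      then show ?thesis
        using dist_to_set_le[OF y, of x] real by (metis ennreal_leI order_trans)
    qed (simp only: top_greatest)
  qed
  then show ?thesis unfolding tail_eq .
qed

section \<open>Absorption and the attractor\<close>

text \<open>The failure of absorption from time \<open>s\<close> on is the projection of a product
  measurable set of pairs \<open>(\<omega>, t)\<close>. A countable dense \<open>D\<close> stands
  for \<open>K\<close> by continuity in space, and integer starting times \<open>s\<close>
  suffice.\<close>

lemma absorption_event_completion:
  assumes F: "closed F"
  shows "absorption_event M \<theta> \<phi> K F \<in> sets (completion M)"
proof -
  obtain D where D: "countable D" "D \<subseteq> K" "K \<subseteq> closure D" by (rule separable)
  define S where "S s = {p \<in> space (M \<Otimes>\<^sub>M borel). real s \<le> snd p \<and>
    (\<exists>x\<in>D. pullback (max 0 (snd p)) (fst p) x \<in> - F)}" for s :: nat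
  have [measurable]: "(\<lambda>p. pullback (max 0 (snd p)) (fst p) x) \<in> M \<Otimes>\<^sub>M borel \<rightarrow>\<^sub>M borel" for x
    using pullback_measurable_pair[of x] by (simp add: case_prod_beta)
  have [measurable]: "- F \<in> sets borel" using F by auto
  have "S s \<in> sets (M \<Otimes>\<^sub>M borel)" for s
    unfolding S_def using D(1) by measurable
  then have proj: "fst ` S s \<in> sets (completion M)" for s
    by (rule measurable_projection)
  have fst_S: "fst ` S s = {\<omega> \<in> space M. \<exists>t\<ge>real s. \<exists>x\<in>D. pullback t \<omega> x \<notin> F}" for s
  proof (intro equalityI subsetI)
    fix \<omega> assume "\<omega> \<in> fst ` S s"
    then obtain t x where "\<omega> \<in> space M" "real s \<le> t" "x \<in> D" "pullback (max 0 t) \<omega> x \<notin> F"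
      unfolding S_def by (auto simp: space_pair_measure)
    moreover from this have "max 0 t = t" by simp
    ultimately show "\<omega> \<in> {\<omega> \<in> space M. \<exists>t\<ge>real s. \<exists>x\<in>D. pullback t \<omega> x \<notin> F}" by auto
  next
    fix \<omega> assume "\<omega> \<in> {\<omega> \<in> space M. \<exists>t\<ge>real s. \<exists>x\<in>D. pullback t \<omega> x \<notin> F}"
    then obtain t x where t: "\<omega> \<in> space M" "real s \<le> t" "x \<in> D" "pullback t \<omega> x \<notin> F" by blast
    moreover from t(2) have "max 0 t = t" by simp
    ultimately have "(\<omega>, t) \<in> S s" unfolding S_def by (auto simp: space_pair_measure)
    then show "\<omega> \<in> fst ` S s" by force
  qed
  have dense: "(\<forall>x\<in>D. pullback t \<omega> x \<in> F) \<longleftrightarrow> (\<forall>x\<in>K. pullback t \<omega> x \<in> F)"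
    if "\<omega> \<in> space M" "0 \<le> t" for t \<omega>
  proof -
    have "pullback t \<omega> ` closure D \<subseteq> F" if "pullback t \<omega> ` D \<subseteq> F"
      using pullback_continuous[OF \<open>\<omega> \<in> space M\<close> \<open>0 \<le> t\<close>] F that
      by (intro image_closure_subset) (auto intro: continuous_on_subset)
    then show ?thesis using D(2,3) by blast
  qed
  have "absorption_event M \<theta> \<phi> K F = (\<Union>s. space M - fst ` S s)"
  proof (intro equalityI subsetI)
    fix \<omega> assume "\<omega> \<in> absorption_event M \<theta> \<phi> K F"
    then obtain s where s: "\<omega> \<in> space M" "0 \<le> s" "\<And>t x. s \<le> t \<Longrightarrow> x \<in> K \<Longrightarrow> pullback t \<omega> x \<in> F"
      unfolding absorption_event_def pullback_def by auto
    obtain n :: nat where n: "s \<le> real n" using real_arch_simple by blast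
    have "pullback t \<omega> x \<in> F" if "real n \<le> t" "x \<in> D" for t x
      using s(3)[of t x] n that D(2) by auto
    then have "\<omega> \<in> space M - fst ` S n" using s(1) unfolding fst_S by blast
    then show "\<omega> \<in> (\<Union>s. space M - fst ` S s)" by blast
  next
    fix \<omega> assume "\<omega> \<in> (\<Union>s. space M - fst ` S s)"
    then obtain n where n: "\<omega> \<in> space M" "\<omega> \<notin> fst ` S n" by blast
    have "\<forall>x\<in>K. pullback t \<omega> x \<in> F" if "real n \<le> t" for t
      using n that dense[OF n(1), of t] unfolding fst_S by fastforce
    then have "K \<subseteq> (\<Inter>t\<in>{real n..}. \<phi> t (\<theta> (- t) \<omega>) -` F)" unfolding pullback_def by auto
    then show "\<omega> \<in> absorption_event M \<theta> \<phi> K F"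
      unfolding absorption_event_def using n(1) of_nat_0_le_iff by blast
  qed
  then show ?thesis using proj by auto
qed

lemma absorption_of_attracting_set:
  assumes K: "compact_random_set M K" and attr: "\<And>B. compact B \<Longrightarrow> strongly_attracts M \<theta> \<phi> K B"
    and \<epsilon>: "0 < \<epsilon>"
  shows "\<exists>C. compact C \<and> (\<forall>\<delta>>0. \<forall>B. compact B \<longrightarrow>
    1 - \<epsilon> \<le> measure (completion M) (absorption_event M \<theta> \<phi> B (closed_nbhd \<delta> C)))"
proof -
  obtain C where C: "compact C" "1 - \<epsilon> \<le> prob {\<omega> \<in> space M. K \<omega> \<subseteq> C}"
    using compact_random_set_tight[OF K \<epsilon>] by blast
  have E: "{\<omega> \<in> space M. K \<omega> \<subseteq> C} \<in> events"
    using K compact_imp_closed[OF C(1)] by (rule compact_random_set_subset_sets)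
  interpret completion: finite_measure "completion M"
    by (intro finite_measureI) simp
  have "1 - \<epsilon> \<le> measure (completion M) (absorption_event M \<theta> \<phi> B (closed_nbhd \<delta> C))"
    if \<delta>: "0 < \<delta>" and B: "compact B" for \<delta> B
  proof -
    have "AE \<omega> in M. attracted \<omega> B (K \<omega>)"
      using attr[OF B] unfolding strongly_attracts_iff .
    then have "AE \<omega> in M. \<omega> \<in> {\<omega> \<in> space M. K \<omega> \<subseteq> C} \<longrightarrow>
        \<omega> \<in> absorption_event M \<theta> \<phi> B (closed_nbhd \<delta> C)"
    proof (rule AE_mp, intro AE_I2 impI)
      fix \<omega> assume "attracted \<omega> B (K \<omega>)" "\<omega> \<in> {\<omega> \<in> space M. K \<omega> \<subseteq> C}"
      then have "attracted \<omega> B C" "\<omega> \<in> space M" by (auto intro: attracted_mono)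
      then show "\<omega> \<in> absorption_event M \<theta> \<phi> B (closed_nbhd \<delta> C)"
        using \<delta> unfolding mem_absorption_event_iff attracted_def by blast
    qed
    then have "measure (completion M) {\<omega> \<in> space M. K \<omega> \<subseteq> C} \<le>
        measure (completion M) (absorption_event M \<theta> \<phi> B (closed_nbhd \<delta> C))"
      using C(1) \<delta> by (intro completion.finite_measure_mono_AE AE_completion absorption_event_completion
          closed_closed_nbhd) auto
    then show ?thesis using C(2) E by simp
  qed
  then show ?thesis using C(1) by blast
qed

text \<open>One event must serve all \<open>B j\<close> and all radii. The \<open>j\<close>-th event
  pairs \<open>B j\<close> with radius \<open>1/(j+1)\<close>; where infinitely many of them occur,
  some \<open>i\<close> is late enough for any given set and radius, and the limsup still has
  probability at least \<open>p\<close>.\<close>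

lemma attracted_event:
  assumes B: "\<And>j::nat. compact (B j)" "incseq B" and p: "0 < p"
    and absorb: "\<And>\<delta> K. 0 < \<delta> \<Longrightarrow> compact K \<Longrightarrow>
      p \<le> measure (completion M) (absorption_event M \<theta> \<phi> K (closed_nbhd \<delta> C))"
  shows "\<exists>G\<in>events. p \<le> prob G \<and> (\<forall>\<omega>\<in>G. \<forall>j. attracted \<omega> (B j) C)"
proof -
  have "\<exists>G\<in>events. G \<subseteq> absorption_event M \<theta> \<phi> (B j) (closed_nbhd (inverse (Suc j)) C) \<and> p \<le> prob G" for j
    using B(1) by (intro completion_inner_approx[OF p absorb]) auto
  then obtain G where G: "\<And>j. G j \<in> events" "\<And>j. p \<le> prob (G j)"
    "\<And>j. G j \<subseteq> absorption_event M \<theta> \<phi> (B j) (closed_nbhd (inverse (Suc j)) C)"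
    by metis
  let ?G = "{\<omega> \<in> space M. \<exists>\<^sub>\<infinity>j. \<omega> \<in> G j}"
  have "attracted \<omega> (B j) C" if \<omega>: "\<exists>\<^sub>\<infinity>j. \<omega> \<in> G j" for \<omega> j
    unfolding attracted_def
  proof (intro allI impI)
    fix e :: real assume "0 < e"
    then obtain n where n: "inverse (Suc n) < e" using reals_Archimedean by blast
    obtain i where i: "max j n \<le> i" "\<omega> \<in> G i" using \<omega> unfolding INFM_nat_le by blast
    have "inverse (Suc i) \<le> inverse (Suc n)" using i(1) by (simp add: divide_simps)
    then have "ennreal (inverse (Suc i)) \<le> ennreal e" using n by (intro ennreal_leI) linarith
    moreover have "B j \<subseteq> B i" using B(2) i(1) by (simp add: incseqD)
    moreover have "\<forall>\<^sub>F t in at_top. \<forall>b\<in>B i. dist_to_set (pullback t \<omega> b) C \<le> ennreal (inverse (Suc i))"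
      using i(2) G(3) mem_absorption_event_iff by blast
    ultimately show "\<forall>\<^sub>F t in at_top. \<forall>b\<in>B j. dist_to_set (pullback t \<omega> b) C \<le> ennreal e"
      by (elim eventually_mono) (blast intro: order_trans)
  qed
  then show ?thesis
    using measure_infinitely_often[of G p, OF G(1,2)] by (intro bexI[of _ ?G]) auto
qed

text \<open>Taking limits along integer times only keeps \<open>A\<close> measurable for \<open>M\<close> itself. Recurrence to the
  sets \<open>C m\<close> shows that the limit set of any compact set along real times is still contained in it.\<close>

lemma strong_C_attractor_exists:
  fixes C :: "nat \<Rightarrow> 'e set" and p :: "nat \<Rightarrow> real"
  assumes C: "\<And>m. compact (C m)" and p: "\<And>m. 0 < p m" "p \<longlonglongrightarrow> 1"
    and absorb: "\<And>m \<delta> K. 0 < \<delta> \<Longrightarrow> compact K \<Longrightarrow>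
      p m \<le> measure (completion M) (absorption_event M \<theta> \<phi> K (closed_nbhd \<delta> (C m)))"
  shows "\<exists>A. strong_C_attractor M \<theta> \<phi> A"
proof -
  have events: "\<exists>G. (\<forall>m. G m \<in> events \<and> p m \<le> prob (G m)) \<and> (\<forall>m. \<forall>\<omega>\<in>G m. \<forall>j. attracted \<omega> (B j) (C m))"
    if B: "\<And>j::nat. compact (B j)" "incseq B" for B
    using attracted_event[OF B p(1) absorb] by metis
  have attr: "AE \<omega> in M. \<exists>m. \<forall>j. attracted \<omega> (B j) (C m)"
    if B: "\<And>j::nat. compact (B j)" "incseq B" for B
  proof -
    obtain G where G: "\<And>m. G m \<in> events" "\<And>m. p m \<le> prob (G m)"
      "\<And>m \<omega>. \<omega> \<in> G m \<Longrightarrow> \<forall>j. attracted \<omega> (B j) (C m)"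
      using events[OF B] by blast
    from AE_ex_event[OF G(1,2) p(2)] show ?thesis by eventually_elim (use G(3) in blast)
  qed
  have recurrent: "AE \<omega> in M. limit_set UNIV \<omega> B \<subseteq> (\<Union>m. limit_set \<nat> \<omega> (C m))" if "compact B" for B
  proof -
    obtain G where G: "\<And>m. G m \<in> events" "\<And>m. p m \<le> prob (G m)"
      "\<And>m \<omega>. \<omega> \<in> G m \<Longrightarrow> attracted \<omega> B (C m)"
      using events[of "\<lambda>_. B"] \<open>compact B\<close> by auto
    \<comment> \<open>Invariance of \<open>M\<close> gives each \<open>H m n\<close> the probability
      of \<open>G m\<close>, so infinitely many \<open>n\<close> occur with probability at least
      \<open>p m\<close>, and \<open>p m\<close> tends to 1.\<close>
    define H where "H m n = \<theta> (- real n) -` G m \<inter> space M" for m n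
    have H: "H m n \<in> events" "p m \<le> prob (H m n)" for m n
      unfolding H_def using G(1,2) by (auto simp: prob_shift)
    have "AE \<omega> in M. \<exists>m. \<omega> \<in> {\<omega> \<in> space M. \<exists>\<^sub>\<infinity>n. \<omega> \<in> H m n}"
      using measure_infinitely_often[OF H] p(2) by (intro AE_ex_event)
    then show ?thesis
    proof eventually_elim
      case (elim \<omega>)
      then obtain m where m: "\<omega> \<in> space M" "\<exists>\<^sub>\<infinity>n. \<omega> \<in> H m n" by blast
      have "\<exists>\<^sub>\<infinity>n. attracted (\<theta> (- real n) \<omega>) B (C m)"
        using m(2) by (rule INFM_mono) (auto simp: H_def G(3))
      then show ?case using limit_set_recurrent[OF m(1) C] by blast
    qed
  qed
  \<comment> \<open>Finite unions make the family increasing, as \<open>attracted_event\<close>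
    demands; so for almost every \<open>\<omega>\<close> one \<open>m\<close> serves all
    \<open>B k\<close>.\<close>
  define B where "B k = (\<Union>i\<le>k. C i)" for k
  have B: "compact (B k)" for k unfolding B_def using C by (intro compact_UN) auto
  have "incseq B" unfolding incseq_def B_def by (intro allI impI UN_mono) auto
  define U where "U \<omega> = (\<Union>k. limit_set \<nat> \<omega> (B k))" for \<omega>
  have C_subset_U: "(\<Union>m. limit_set \<nat> \<omega> (C m)) \<subseteq> U \<omega>" for \<omega>
    unfolding U_def by (intro UN_mono limit_set_mono) (auto simp: B_def)
  have "AE \<omega> in M. \<forall>k. limit_set UNIV \<omega> (B k) \<subseteq> (\<Union>m. limit_set \<nat> \<omega> (C m))"
    unfolding AE_all_countable using recurrent B by blast
  with attr[OF B \<open>incseq B\<close>]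
  have "AE \<omega> in M. (\<exists>m. \<forall>k. attracted \<omega> (B k) (C m)) \<and> (\<forall>k. limit_set UNIV \<omega> (B k) \<subseteq> U \<omega>)"
    by eventually_elim (use C_subset_U in blast)
  \<comment> \<open>The exceptional set itself need not be measurable; enlarging it to a null set of
    \<open>M\<close> makes the case distinction on \<open>G\<close> measurable.\<close>
  then obtain N where N: "N \<in> null_sets M"
    "{\<omega> \<in> space M. \<not> ((\<exists>m. \<forall>k. attracted \<omega> (B k) (C m)) \<and> (\<forall>k. limit_set UNIV \<omega> (B k) \<subseteq> U \<omega>))} \<subseteq> N"
    unfolding eventually_ae_filter by blast
  define G where "G = space M - N"
  have G_sets[measurable]: "G \<in> sets M" unfolding G_def using N(1) by auto
  have AE_G: "AE \<omega> in M. \<omega> \<in> G" unfolding G_def using AE_not_in[OF N(1)] by auto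
  have G_space: "\<omega> \<in> space M" if "\<omega> \<in> G" for \<omega> using that unfolding G_def by blast
  have G_attr: "\<exists>m. \<forall>k. attracted \<omega> (B k) (C m)" if "\<omega> \<in> G" for \<omega>
    using that N(2) unfolding G_def by blast
  \<comment> \<open>On \<open>G\<close> integer and real times give the same union, so measurability
    is read off one side and invariance off the other.\<close>
  have U_eq: "U \<omega> = (\<Union>k. limit_set UNIV \<omega> (B k))" if "\<omega> \<in> G" for \<omega>
  proof (rule antisym)
    show "U \<omega> \<subseteq> (\<Union>k. limit_set UNIV \<omega> (B k))"
      unfolding U_def by (intro UN_mono limit_set_mono) auto
    show "(\<Union>k. limit_set UNIV \<omega> (B k)) \<subseteq> U \<omega>"
      using that N(2) unfolding G_def by blast
  qed
  have U_compact: "compact (closure (U \<omega>))" if \<omega>: "\<omega> \<in> G" for \<omega>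
  proof -
    obtain m where "\<And>k. attracted \<omega> (B k) (C m)" using G_attr[OF \<omega>] by blast
    then have "U \<omega> \<subseteq> C m" unfolding U_def using limit_set_subset[OF _ C] by blast
    then have "closure (U \<omega>) \<subseteq> C m" by (rule closure_minimal[OF _ compact_imp_closed[OF C]])
    then show ?thesis using C by (metis closed_closure compact_Int_closed inf.absorb_iff2)
  qed
  define A where "A \<omega> = (if \<omega> \<in> G then closure (U \<omega>) else {})" for \<omega>
  have "compact_random_set M A"
    unfolding compact_random_set_def
  proof (intro conjI ballI allI)
    show "compact (A \<omega>)" for \<omega> unfolding A_def using U_compact by auto
    show "(\<lambda>\<omega>. dist_to_set x (A \<omega>)) \<in> borel_measurable M" for x
    proof -
      have "\<forall>k. \<exists>D. countable D \<and> D \<subseteq> B k \<and> B k \<subseteq> closure D" by (meson separable)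
      then obtain D where D: "\<And>k. countable (D k)" "\<And>k. D k \<subseteq> B k" "\<And>k. B k \<subseteq> closure (D k)"
        by metis
      have [measurable]: "(\<lambda>\<omega>. pullback (real n) \<omega> y) \<in> borel_measurable M" for n y
        by (rule pullback_measurable) simp
      define h where "h \<omega> = (INF k. SUP s. INF n\<in>{s::nat..}. INF b\<in>D k.
        ennreal (dist x (pullback (real n) \<omega> b)))" for \<omega>
      have "h \<in> borel_measurable M"
        unfolding h_def using D(1)
        by (intro borel_measurable_INF borel_measurable_SUP measurable_compose[OF _ measurable_ennreal]
            borel_measurable_dist) auto
      then have "(\<lambda>\<omega>. if \<omega> \<in> G then h \<omega> else \<top>) \<in> borel_measurable M" by measurable
      moreover have "dist_to_set x (A \<omega>) = (if \<omega> \<in> G then h \<omega> else \<top>)" for \<omega>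
      proof (cases "\<omega> \<in> G")
        case True
        obtain m where m: "\<And>k. attracted \<omega> (B k) (C m)" using G_attr[OF True] by blast
        have "dist_to_set x (A \<omega>) = dist_to_set x (U \<omega>)"
          unfolding A_def using True by (simp add: dist_to_set_closure)
        also have "\<dots> = (INF k. dist_to_set x (limit_set \<nat> \<omega> (B k)))"
          unfolding U_def dist_to_set_def
          by (rule antisym) (auto intro!: INF_greatest intro: INF_lower2 INF_lower)
        also have "\<dots> = h \<omega>"
          unfolding h_def by (intro INF_cong refl dist_to_set_limit_set[OF G_space[OF True] m C D(2,3)])
        finally show ?thesis using True by simp
      qed (simp add: A_def)
      ultimately show ?thesis by simp
    qed
    show "AE \<omega> in M. A \<omega> \<noteq> {}"
    proof -
      \<comment> \<open>Nothing says that \<open>C 0\<close> is non-empty. It attracts a one-point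
        set on an event of positive probability, so it contains a non-empty limit set.\<close>
      obtain G0 where "p 0 \<le> prob G0" "\<And>\<omega>. \<omega> \<in> G0 \<Longrightarrow> attracted \<omega> {undefined} (C 0)"
        using events[of "\<lambda>_. {undefined}"] by (auto simp: incseq_def)
      moreover from this(1) p(1)[of 0] have "G0 \<noteq> {}" by auto
      ultimately obtain \<omega>0 where "attracted \<omega>0 {undefined} (C 0)" by blast
      from limit_set_nonempty[OF this C] limit_set_subset[OF this C] have "C 0 \<noteq> {}" by blast
      then have "B 0 \<noteq> {}" unfolding B_def by auto
      have "A \<omega> \<noteq> {}" if \<omega>: "\<omega> \<in> G" for \<omega>
      proof -
        obtain m where m: "\<And>k. attracted \<omega> (B k) (C m)" using G_attr[OF \<omega>] by blast
        have "limit_set \<nat> \<omega> (B 0) \<noteq> {}" using limit_set_nonempty[OF m C \<open>B 0 \<noteq> {}\<close>] .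
        then show ?thesis unfolding A_def U_def using \<omega> by auto
      qed
      with AE_G show ?thesis by (auto elim: eventually_mono)
    qed
  qed
  moreover have "strictly_invariant M \<theta> \<phi> A"
    unfolding strictly_invariant_def
  proof (intro allI impI)
    fix t :: real assume t: "0 \<le> t"
    from AE_G AE_shift[OF AE_G, of t] show "AE \<omega> in M. \<phi> t \<omega> ` A \<omega> = A (\<theta> t \<omega>)"
    proof eventually_elim
      case (elim \<omega>)
      note \<omega> = G_space[OF elim(1)]
      obtain m where m: "\<And>k. attracted \<omega> (B k) (C m)" using G_attr[OF elim(1)] by blast
      have "\<phi> t \<omega> ` limit_set UNIV \<omega> (B k) = limit_set UNIV (\<theta> t \<omega>) (B k)" for k
        using limit_set_image_subset[OF \<omega> t] limit_set_subset_image[OF \<omega> t m C] by (intro antisym)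
      then have "\<phi> t \<omega> ` U \<omega> = U (\<theta> t \<omega>)"
        unfolding U_eq[OF elim(1)] U_eq[OF elim(2)] image_UN by simp
      moreover have "\<phi> t \<omega> ` closure (U \<omega>) = closure (\<phi> t \<omega> ` U \<omega>)"
        using cocycle_continuous[OF \<omega> t] U_compact[OF elim(1)] by (rule compact_image_closure)
      ultimately show ?case unfolding A_def using elim by simp
    qed
  qed
  moreover have "AE \<omega> in M. attracted \<omega> B' (A \<omega>)" if "compact B'" for B'
  proof -
    have "AE \<omega> in M. \<exists>m. \<forall>j::nat. attracted \<omega> B' (C m)"
      using attr[of "\<lambda>_. B'"] that by (simp add: incseq_def)
    with AE_G recurrent[OF that] show ?thesis
    proof eventually_elim
      case (elim \<omega>)
      then obtain m where "attracted \<omega> B' (C m)" by blast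
      then have "attracted \<omega> B' (limit_set UNIV \<omega> B')" using C by (rule attracted_limit_set)
      moreover have "limit_set UNIV \<omega> B' \<subseteq> A \<omega>"
        unfolding A_def using elim(1,2) C_subset_U[of \<omega>] closure_subset[of "U \<omega>"] by simp
      ultimately show ?case by (rule attracted_mono[OF _ order_refl])
    qed
  qed
  ultimately show ?thesis
    unfolding strong_C_attractor_def attracted_iff_tendsto by blast
qed

end

theorem theorem3p2:
  fixes M :: "'w measure"
    and \<theta> :: "real \<Rightarrow> 'w \<Rightarrow> 'w"
    and \<phi> :: "real \<Rightarrow> 'w \<Rightarrow> 'e::polish_space \<Rightarrow> 'e"
  assumes "continuous_rds M \<theta> \<phi>"
  shows "((\<exists>A. strong_C_attractor M \<theta> \<phi> A) \<longleftrightarrow>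
          (\<forall>\<epsilon>>0. \<exists>C. compact C \<and>
             (\<forall>\<delta>>0. \<forall>K. compact K \<longrightarrow>
                measure (completion M) (absorption_event M \<theta> \<phi> K (closed_nbhd \<delta> C)) \<ge> 1 - \<epsilon>)))
       \<and> ((\<exists>A. strong_C_attractor M \<theta> \<phi> A) \<longleftrightarrow>
          (\<exists>K. compact_random_set M K \<and>
             (\<forall>B. compact B \<longrightarrow> strongly_attracts M \<theta> \<phi> K B)))"
    (is "(?i \<longleftrightarrow> ?ii) \<and> (?i \<longleftrightarrow> ?iii)")
proof -
  interpret continuous_rds M \<theta> \<phi> by fact
  have 1: "?i \<Longrightarrow> ?iii"
    unfolding strong_C_attractor_def strongly_attracts_iff attracted_iff_tendsto by blast
  have 2: "?iii \<Longrightarrow> ?ii"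
    using absorption_of_attracting_set by metis
  have 3: ?i if ii: ?ii
  proof -
    \<comment> \<open>The offset 2 makes already \<open>p 0 = 1/2\<close> positive. A zero bound
      would guarantee neither measurability of the absorption event nor that any
      \<open>\<omega>\<close> lies in it.\<close>
    define p where "p m = 1 - inverse (real (m + 2))" for m
    have "\<exists>C. compact C \<and> (\<forall>\<delta>>0. \<forall>K. compact K \<longrightarrow>
        p m \<le> measure (completion M) (absorption_event M \<theta> \<phi> K (closed_nbhd \<delta> C)))" for m
      unfolding p_def using ii by simp
    then obtain C where C: "\<And>m. compact (C m)" "\<And>m \<delta> K. 0 < \<delta> \<Longrightarrow> compact K \<Longrightarrow>
        p m \<le> measure (completion M) (absorption_event M \<theta> \<phi> K (closed_nbhd \<delta> (C m)))"
      by metis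
    have pos: "0 < p m" for m unfolding p_def by (simp add: field_simps)
    have lim: "p \<longlonglongrightarrow> 1"
      unfolding p_def using tendsto_diff[OF tendsto_const LIMSEQ_ignore_initial_segment[OF lim_inverse_n, of 2], of 1] by simp
    show ?i by (rule strong_C_attractor_exists[of C p, OF C(1) pos lim C(2)])
  qed
  show ?thesis
  proof (intro conjI iffI)
    show ?ii if ?i by (rule 2[OF 1[OF that]])
    show ?i if ?ii by (rule 3[OF that])
    show ?iii if ?i by (rule 1[OF that])
    show ?i if ?iii by (rule 3[OF 2[OF that]])
  qed
qed

end
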